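(* Let $\mu$ and $\nu$ be symmetric Lévy measures on $\mathbb{R}^m\setminus\{0\}$ and $\mathbb{R}^n\setminus\{0\}$, each with full support, and let $\Phi(x)=\int(1-\cos\langle x,s\rangle)\,\mu(ds)$, $\Psi(y)=\int(1-\cos\langle y,t\rangle)\,\nu(dt)$. Let $(X,Y)$ be a random vector with values in $\mathbb{R}^{m+n}$ such that $\mathbb{E}[\Phi(X)+\Psi(Y)]<\infty$, let $(X_i,Y_i)_{i\in\mathbb{N}}$ be i.i.d. copies of $(X,Y)$, and write $\boldsymbol X=(X_1,\dots,X_N)$, $\boldsymbol Y=(Y_1,\dots,Y_N)$. Then $$\widehat V_N^2(\boldsymbol X,\boldsymbol Y)\xrightarrow[N\to\infty]{} V^2(X,Y)\quad\text{almost surely.}$$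
   Context: A symmetric Lévy measure on $\mathbb{R}^d\setminus\{0\}$ is a measure $\rho$ with $\rho(B)=\rho(-B)$ for all Borel $B$ and $\int(1\wedge|r|^2)\,\rho(dr)<\infty$; it has full support if $\rho(G)>0$ for every nonempty open $G\subset\mathbb{R}^d\setminus\{0\}$. For random vectors $X$ in $\mathbb{R}^m$, $Y$ in $\mathbb{R}^n$, with characteristic functions $f_X(s)=\mathbb{E}e^{i\langle s,X\rangle}$, $f_Y$, $f_{(X,Y)}$, the generalized distance covariance is $V^2(X,Y)=\iint|f_{(X,Y)}(s,t)-f_X(s)f_Y(t)|^2\,\mu(ds)\,\nu(dt)\in[0,\infty]$. For points $(x_1,y_1),\dots,(x_N,y_N)\in\mathbb{R}^{m+n}$ the estimator is $$\widehat V_N^2=\frac1{N^4}\sum_{i,j,k,l=1}^N\big[\Phi(x_i-x_k)\Psi(y_i-y_k)-2\Phi(x_i-x_j)\Psi(y_i-y_l)+\Phi(x_i-x_j)\Psi(y_k-y_l)\big],$$ written $\widehat V_N^2(\boldsymbol x,\boldsymbol y)$ with $\boldsymbol x=(x_1,\dots,x_N)$, $\boldsymbol y=(y_1,\dots,y_N)$. *)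

theory Defs
  imports "HOL-Probability.Probability"
begin

text \<open>Symmetric Levy measure on the punctured space (realised as a Borel measure
  on the whole space giving zero mass to the origin).\<close>
definition sym_levy_measure :: "'a::euclidean_space measure \<Rightarrow> bool" where
  "sym_levy_measure \<rho> \<longleftrightarrow>
     sets \<rho> = sets borel \<and>
     emeasure \<rho> {0} = 0 \<and>
     (\<forall>B \<in> sets borel. emeasure \<rho> B = emeasure \<rho> (uminus ` B)) \<and>
     (\<integral>\<^sup>+ r. ennreal (min 1 (norm r ^ 2)) \<partial>\<rho>) < \<infinity>"

definition full_support :: "'a::euclidean_space measure \<Rightarrow> bool" where
  "full_support \<rho> \<longleftrightarrow>
     (\<forall>G. open G \<and> G \<subseteq> - {0} \<and> G \<noteq> {} \<longrightarrow> emeasure \<rho> G > 0)"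

definition levy_fun :: "'a::euclidean_space measure \<Rightarrow> 'a \<Rightarrow> real" where
  "levy_fun \<mu> x = (\<integral> s. (1 - cos (x \<bullet> s)) \<partial>\<mu>)"

definition charf :: "'w measure \<Rightarrow> ('w \<Rightarrow> 'a::euclidean_space) \<Rightarrow> 'a \<Rightarrow> complex" where
  "charf M X s = (\<integral> \<omega>. cis (s \<bullet> X \<omega>) \<partial>M)"

definition joint_charf :: "'w measure \<Rightarrow> ('w \<Rightarrow> 'a::euclidean_space) \<Rightarrow> ('w \<Rightarrow> 'b::euclidean_space)
    \<Rightarrow> 'a \<Rightarrow> 'b \<Rightarrow> complex" where
  "joint_charf M X Y s t = (\<integral> \<omega>. cis (s \<bullet> X \<omega> + t \<bullet> Y \<omega>) \<partial>M)"

definition dcov2 :: "'a::euclidean_space measure \<Rightarrow> 'b::euclidean_space measure \<Rightarrow>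
    'w measure \<Rightarrow> ('w \<Rightarrow> 'a) \<Rightarrow> ('w \<Rightarrow> 'b) \<Rightarrow> ennreal" where
  "dcov2 \<mu> \<nu> M X Y =
     (\<integral>\<^sup>+ s. (\<integral>\<^sup>+ t. ennreal ((cmod (joint_charf M X Y s t - charf M X s * charf M Y t))\<^sup>2) \<partial>\<nu>) \<partial>\<mu>)"

definition dcov2_est :: "('a \<Rightarrow> real) \<Rightarrow> ('b \<Rightarrow> real) \<Rightarrow> nat \<Rightarrow>
    (nat \<Rightarrow> 'a::euclidean_space) \<Rightarrow> (nat \<Rightarrow> 'b::euclidean_space) \<Rightarrow> real" where
  "dcov2_est \<Phi> \<Psi> N x y =
     (1 / real N ^ 4) *
     (\<Sum>i<N. \<Sum>j<N. \<Sum>k<N. \<Sum>l<N.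
        \<Phi> (x i - x k) * \<Psi> (y i - y k)
        - 2 * \<Phi> (x i - x j) * \<Psi> (y i - y l)
        + \<Phi> (x i - x j) * \<Psi> (y k - y l))"

end

theory Submission
  imports Defs
begin

text \<open>Write \<open>h\<close> for the joint characteristic function minus the product of the marginal ones,
  and \<open>h\<^sub>N\<close> for its empirical counterpart. Averaging \<open>|h\<^sub>N(s, t)|\<^sup>2\<close> with
  \<open>|h\<^sub>N(- s, t)|\<^sup>2\<close> gives a combination of products
  \<open>(1 - cos \<langle>x\<^sub>i - x\<^sub>j, s\<rangle>) (1 - cos \<langle>y\<^sub>k - y\<^sub>l, t\<rangle>)\<close>, so by symmetry of \<open>\<mu>\<close> the
  estimator is the integral of \<open>|h\<^sub>N|\<^sup>2\<close>. By the strong law and Fubini, almost surely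
  \<open>h\<^sub>N \<longlonglongrightarrow> h\<close> almost everywhere. By Cauchy--Schwarz \<open>|h\<^sub>N|\<^sup>2\<close> is at most
  \<open>4 (1 - Re f\<^sub>X\<^sub>,\<^sub>N(s)) (1 - Re f\<^sub>Y\<^sub>,\<^sub>N(t))\<close>, whose integral is four times the product of the sample
  means of \<open>\<Phi>(X\<^sub>i)\<close> and \<open>\<Psi>(Y\<^sub>i)\<close>. These converge to the expectations by the strong law,
  so a dominated convergence theorem with varying majorants applies.\<close>

subsection \<open>The strong law of large numbers\<close>

lemma geometric_sum_below:
  fixes a x :: real
  assumes "a > 1" "x \<ge> 0"
  shows "(\<Sum>n<N. if a ^ n < x then a ^ n else 0) \<le> a * x / (a - 1)"
proof -
  \<comment> \<open>The minimum makes the bound inductive: the sum is below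
    \<open>a ^ N / (a - 1)\<close> as a plain geometric sum, and it stops growing once the powers
    reach \<open>x\<close>, when the next power is at most \<open>a * x\<close>.\<close>
  have "(\<Sum>n<N. if a ^ n < x then a ^ n else 0) \<le> min (a ^ N) (a * x) / (a - 1)"
  proof (induction N)
    case 0
    show ?case using assms by simp
  next
    case (Suc N)
    show ?case
    proof (cases "a ^ N < x")
      case True
      then have "a ^ Suc N < a * x" using assms by simp
      then have "min (a ^ Suc N) (a * x) / (a - 1) = a ^ N / (a - 1) + a ^ N"
        using assms by (simp add: field_simps)
      moreover have "min (a ^ N) (a * x) / (a - 1) \<le> a ^ N / (a - 1)"
        using assms by (intro divide_right_mono) auto
      ultimately show ?thesis using Suc True by simp
    next
      case False
      have "a ^ N \<le> a ^ Suc N" using assms by (intro power_increasing) auto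
      then have "min (a ^ N) (a * x) / (a - 1) \<le> min (a ^ Suc N) (a * x) / (a - 1)"
        using assms by (intro divide_right_mono min.mono) auto
      then show ?thesis using Suc False by simp
    qed
  qed
  also have "\<dots> \<le> a * x / (a - 1)" using assms by (intro divide_right_mono) auto
  finally show ?thesis .
qed

lemma geometric_sum_above:
  fixes a y :: real
  assumes "a > 1" "y > 0"
  shows "(\<Sum>n<N. if y \<le> a ^ n then 1 / a ^ n else 0) \<le> a / (y * (a - 1))"
proof -
  \<comment> \<open>The terms telescope, since \<open>1 / a ^ n\<close> is the difference of
    \<open>a / a ^ n\<close> and \<open>a / a ^ Suc n\<close> divided by \<open>a - 1\<close>. The
    \<open>max 0\<close> covers the \<open>N\<close> for which no term has been counted yet and the
    difference may be negative.\<close>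
  have "(\<Sum>n<N. if y \<le> a ^ n then 1 / a ^ n else 0) \<le> max 0 (a / y - a / a ^ N) / (a - 1)"
  proof (induction N)
    case 0
    show ?case using assms by simp
  next
    case (Suc N)
    have aN: "a ^ N > 0" using assms by simp
    have mono: "a / y - a / a ^ N \<le> a / y - a / a ^ Suc N"
      using assms by (intro diff_left_mono divide_left_mono power_increasing) auto
    show ?case
    proof (cases "y \<le> a ^ N")
      case True
      then have "a / a ^ N \<le> a / y" using assms by (intro divide_left_mono) auto
      then have "max 0 (a / y - a / a ^ N) = a / y - a / a ^ N"
        "max 0 (a / y - a / a ^ Suc N) = a / y - a / a ^ Suc N"
        using mono by auto
      moreover have "(a / y - a / a ^ N) / (a - 1) + 1 / a ^ N = (a / y - a / a ^ Suc N) / (a - 1)"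
        using assms aN by (simp add: field_simps)
      ultimately have "max 0 (a / y - a / a ^ N) / (a - 1) + 1 / a ^ N = max 0 (a / y - a / a ^ Suc N) / (a - 1)"
        by metis
      then show ?thesis using Suc True by simp
    next
      case False
      have "max 0 (a / y - a / a ^ N) / (a - 1) \<le> max 0 (a / y - a / a ^ Suc N) / (a - 1)"
        using mono assms by (intro divide_right_mono) auto
      then show ?thesis using Suc False by simp
    qed
  qed
  also have "\<dots> \<le> (a / y) / (a - 1)"
    using assms by (intro divide_right_mono) auto
  finally show ?thesis by simp
qed

text \<open>The sample sizes along which the strong law is proved first. For \<open>a > 1\<close>,
  rounding up makes each of them positive and at most twice the power.\<close>

definition geom_index :: "real \<Rightarrow> nat \<Rightarrow> nat" where
  "geom_index a n = nat \<lceil>a ^ n\<rceil>"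

lemma geom_index_bounds:
  assumes "a > 1"
  shows "a ^ n \<le> real (geom_index a n)" "real (geom_index a n) \<le> a ^ n + 1"
    "real (geom_index a n) \<le> 2 * a ^ n" "geom_index a n > 0"
proof -
  have "a ^ n \<ge> 1" using assms by simp
  moreover have "a ^ n \<le> of_int \<lceil>a ^ n\<rceil>" "of_int \<lceil>a ^ n\<rceil> < a ^ n + 1" by linarith+
  moreover have "real (geom_index a n) = of_int \<lceil>a ^ n\<rceil>"
    unfolding geom_index_def using \<open>a ^ n \<ge> 1\<close> by simp
  ultimately show "a ^ n \<le> real (geom_index a n)" "real (geom_index a n) \<le> a ^ n + 1"
    "real (geom_index a n) \<le> 2 * a ^ n" "geom_index a n > 0"
    by linarith+
qed

lemma realpow_at_top:
  fixes a :: real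
  assumes "a > 1"
  shows "filterlim (\<lambda>n. a ^ n) at_top sequentially"
  using filterlim_realpow_sequentially_gt1[of a] assms
  by (simp add: filterlim_at_infinity_conv_norm_at_top)

lemma geom_index_at_top:
  assumes "a > 1"
  shows "filterlim (\<lambda>n. real (geom_index a n)) at_top sequentially"
  using realpow_at_top[OF assms]
  by (rule filterlim_at_top_mono) (use geom_index_bounds[OF assms] in auto)

text \<open>Rounding costs a factor 2 against \<open>geometric_sum_below\<close>. With
  \<open>x\<close> a value of a nonnegative variable \<open>Y\<close>, taking expectations bounds
  the sum of k P(Y > k) over the rounded powers k by a multiple of the mean of
  \<open>Y\<close>.\<close>

lemma geom_index_sum_below:
  assumes "a > 1" "x \<ge> 0"
  shows "(\<Sum>n<N. if real (geom_index a n) < x then real (geom_index a n) else 0) \<le> 2 * a / (a - 1) * x"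
proof -
  note k = geom_index_bounds[OF assms(1)]
  have "(\<Sum>n<N. if real (geom_index a n) < x then real (geom_index a n) else 0)
      \<le> (\<Sum>n<N. 2 * (if a ^ n < x then a ^ n else 0))"
  proof (intro sum_mono)
    fix n
    show "(if real (geom_index a n) < x then real (geom_index a n) else 0)
      \<le> 2 * (if a ^ n < x then a ^ n else 0)"
      using k(1,3)[of n] assms by auto
  qed
  also have "\<dots> \<le> 2 * (a * x / (a - 1))"
    unfolding sum_distrib_left[symmetric] by (intro mult_left_mono geometric_sum_below assms) auto
  finally show ?thesis by (simp add: mult.assoc)
qed

text \<open>If \<open>x\<close> is at most the rounded power, then \<open>x / 2\<close> is at most
  the power, so \<open>geometric_sum_above\<close> applies at \<open>x / 2\<close>. Taking
  expectations bounds the sum of the truncated second moments, each divided by its truncation level,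
  by a multiple of the first moment alone.\<close>

lemma geom_index_sum_above:
  assumes "a > 1" "x \<ge> 0"
  shows "(\<Sum>n<N. if x \<le> real (geom_index a n) then x\<^sup>2 / real (geom_index a n) else 0)
    \<le> 2 * a / (a - 1) * x"
proof (cases "x = 0")
  case False
  with assms have x: "x > 0" by simp
  note k = geom_index_bounds[OF assms(1)]
  have "(\<Sum>n<N. if x \<le> real (geom_index a n) then x\<^sup>2 / real (geom_index a n) else 0)
      \<le> (\<Sum>n<N. x\<^sup>2 * (if x / 2 \<le> a ^ n then 1 / a ^ n else 0))"
  proof (intro sum_mono)
    fix n
    have "x\<^sup>2 / real (geom_index a n) \<le> x\<^sup>2 / a ^ n"
      using k(1)[of n] k(4)[of n] assms(1) by (intro divide_left_mono mult_pos_pos) auto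
    then show "(if x \<le> real (geom_index a n) then x\<^sup>2 / real (geom_index a n) else 0)
      \<le> x\<^sup>2 * (if x / 2 \<le> a ^ n then 1 / a ^ n else 0)"
      using k(3)[of n] assms by auto
  qed
  also have "\<dots> \<le> x\<^sup>2 * (a / (x / 2 * (a - 1)))"
    unfolding sum_distrib_left[symmetric]
    using geometric_sum_above[OF assms(1), of "x / 2" N] x by (intro mult_left_mono) auto
  also have "\<dots> = 2 * a / (a - 1) * x"
    using x assms(1) by (simp add: power2_eq_square divide_simps)
  finally show ?thesis .
qed simp

text \<open>A Borel-Cantelli argument: the integral of the series is the series of the integrals,
  hence finite, so the series converges almost everywhere and its terms vanish in the limit.\<close>

lemma AE_tendsto_zero_if_integrals_summable:
  fixes f :: "nat \<Rightarrow> 'a \<Rightarrow> real"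
  assumes int: "\<And>n. integrable M (f n)" and nn: "\<And>n x. f n x \<ge> 0"
    and bd: "\<And>N. (\<Sum>n<N. integral\<^sup>L M (f n)) \<le> C"
  shows "AE x in M. (\<lambda>n. f n x) \<longlonglongrightarrow> 0"
proof -
  have [measurable]: "f n \<in> borel_measurable M" for n using int by auto
  have "(\<integral>\<^sup>+x. (\<Sum>n. ennreal (f n x)) \<partial>M) = (\<Sum>n. \<integral>\<^sup>+x. ennreal (f n x) \<partial>M)"
    by (rule nn_integral_suminf) simp
  also have "\<dots> = (\<Sum>n. ennreal (integral\<^sup>L M (f n)))"
    using nn_integral_eq_integral[OF int] nn by simp
  also have "\<dots> \<le> ennreal C"
  proof (rule suminf_le_const)
    fix N
    have "(\<Sum>n<N. ennreal (integral\<^sup>L M (f n))) = ennreal (\<Sum>n<N. integral\<^sup>L M (f n))"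
      using nn by (intro sum_ennreal) simp
    then show "(\<Sum>n<N. ennreal (integral\<^sup>L M (f n))) \<le> ennreal C"
      using bd[of N] ennreal_leI by metis
  qed simp
  finally have "(\<integral>\<^sup>+x. (\<Sum>n. ennreal (f n x)) \<partial>M) \<noteq> \<infinity>"
    using ennreal_less_top[of C] by (auto simp: top_unique)
  then have "AE x in M. (\<Sum>n. ennreal (f n x)) \<noteq> \<infinity>"
    by (intro nn_integral_PInf_AE) auto
  then show ?thesis
  proof eventually_elim
    case (elim x)
    then have "summable (\<lambda>n. f n x)"
      using nn by (intro summable_suminf_not_top) auto
    then show ?case by (rule summable_LIMSEQ_zero)
  qed
qed

text \<open>Monotonicity sandwiches \<open>S N\<close> between its values at two consecutive rounded
  powers. Their ratio is asymptotically \<open>a\<close>, so the averages are eventually within a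
  factor close to \<open>a\<close> of \<open>m\<close>, and \<open>a\<close> may be taken close to
  1. Only countably many ratios occur, which later allows the exceptional null sets to be
  united.\<close>

lemma averages_tendsto_if_along_geom_index:
  fixes S :: "nat \<Rightarrow> real"
  assumes mono: "mono S" and nn: "\<And>n. S n \<ge> 0"
    and lim: "\<And>q. (\<lambda>n. S (geom_index (1 + 1 / real (Suc q)) n) / real (geom_index (1 + 1 / real (Suc q)) n))
      \<longlonglongrightarrow> m"
  shows "(\<lambda>n. S n / real n) \<longlonglongrightarrow> m"
proof -
  have m: "m \<ge> 0" using lim[of 0] nn by (intro LIMSEQ_le_const) auto
  have bounds: "eventually (\<lambda>N. (m - e) / (a * (1 + e)) \<le> S N / N \<and> S N / N \<le> a * (1 + e) * (m + e)) sequentially"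
    if e: "e > 0" and a: "a = 1 + 1 / real (Suc q)" for e a q
  proof -
    have a1: "a > 1" using a by simp
    note k = geom_index_bounds[OF a1]
    let ?k = "geom_index a"
    have "(\<lambda>n. S (?k n) / real (?k n)) \<longlonglongrightarrow> m" using lim[of q] a by simp
    then have "eventually (\<lambda>n. dist (S (?k n) / real (?k n)) m < e) sequentially"
      using e tendstoD by blast
    \<comment> \<open>From here on the rounding error of at most 1 is below
      \<open>e * a ^ n\<close>, so it can be absorbed into the factor \<open>1 + e\<close>.\<close>
    moreover have "eventually (\<lambda>n. a ^ n > 1 / e) sequentially"
      using realpow_at_top[OF a1] by (simp add: filterlim_at_top_dense)
    ultimately have "eventually (\<lambda>n. dist (S (?k n) / real (?k n)) m < e \<and> a ^ n > 1 / e) sequentially"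
      by (rule eventually_conj)
    then obtain n0 where n0: "\<And>n. n \<ge> n0 \<Longrightarrow> \<bar>S (?k n) / real (?k n) - m\<bar> < e \<and> a ^ n > 1 / e"
      by (auto simp: eventually_sequentially dist_real_def)
    have "(m - e) / (a * (1 + e)) \<le> S N / N \<and> S N / N \<le> a * (1 + e) * (m + e)" if N: "N \<ge> ?k n0" for N
    proof -
      have N0: "N > 0" using k(4)[of n0] N by linarith
      have fin: "finite {n. ?k n \<le> N}"
      proof -
        have "eventually (\<lambda>n. real (?k n) > real N) sequentially"
          using geom_index_at_top[OF a1] unfolding filterlim_at_top_dense by blast
        then have "eventually (\<lambda>n. ?k n > N) sequentially" by simp
        then obtain n1 where "\<And>n. n \<ge> n1 \<Longrightarrow> ?k n > N"
          by (auto simp: eventually_sequentially)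
        then have "{n. ?k n \<le> N} \<subseteq> {..<n1}" by (auto simp: not_less[symmetric])
        then show ?thesis by (rule finite_subset) simp
      qed
      \<comment> \<open>Maximality places \<open>N\<close> between \<open>?k n\<close> and
        \<open>?k (Suc n)\<close>.\<close>
      define n where "n = Max {n. ?k n \<le> N}"
      have "n \<in> {n. ?k n \<le> N}" unfolding n_def using N by (intro Max_in[OF fin]) auto
      then have kn: "?k n \<le> N" by simp
      have nn0: "n \<ge> n0" unfolding n_def using N by (intro Max_ge[OF fin]) auto
      have kS: "?k (Suc n) \<ge> N"
      proof (rule ccontr)
        assume "\<not> ?k (Suc n) \<ge> N"
        then have "Suc n \<le> n" unfolding n_def using fin by (intro Max_ge) (auto simp: n_def[symmetric])
        then show False by simp
      qed
      have r: "real (?k (Suc n)) \<le> a * (1 + e) * real (?k n)"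
      proof -
        have an: "1 < e * a ^ n" using n0[OF nn0] e by (simp add: field_simps)
        have "real (?k (Suc n)) \<le> a * a ^ n + 1" using k(2)[of "Suc n"] by simp
        also have "\<dots> \<le> a * a ^ n + a * (e * a ^ n)"
        proof -
          have "1 * 1 \<le> a * (e * a ^ n)" using an a1 by (intro mult_mono) auto
          then show ?thesis by simp
        qed
        also have "\<dots> = a * (1 + e) * a ^ n" by (simp add: algebra_simps)
        also have "\<dots> \<le> a * (1 + e) * real (?k n)" using k(1)[of n] a1 e by (intro mult_left_mono) auto
        finally show ?thesis .
      qed
      define c where "c = a * (1 + e)"
      have c: "c > 0" unfolding c_def using a1 e by simp
      have kp: "real (?k n) > 0" "real (?k (Suc n)) > 0" using k(4) by auto
      have lo: "(m - e) * real (?k n) \<le> S (?k n)"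
        using n0[OF nn0] kp by (auto simp: abs_less_iff field_simps)
      have up: "S (?k (Suc n)) \<le> (m + e) * real (?k (Suc n))"
        using n0[of "Suc n"] nn0 kp by (auto simp: abs_less_iff field_simps)
      have "S N \<le> (m + e) * real (?k (Suc n))" using monoD[OF mono kS] up by linarith
      also have "\<dots> \<le> (m + e) * (c * real N)"
      proof (rule mult_left_mono)
        have "c * real (?k n) \<le> c * real N" using kn c by simp
        then show "real (?k (Suc n)) \<le> c * real N" using r unfolding c_def by (rule order_trans[rotated])
      qed (use m e in simp)
      finally have A: "S N / N \<le> c * (m + e)" using N0 by (simp add: field_simps)
      have "(m - e) * real N \<le> c * S N"
      \<comment> \<open>Multiplication by \<open>m - e\<close> preserves inequalities only when it
        is nonnegative. Otherwise the left side is at most 0 and the right side at least 0.\<close>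
      proof (cases "m - e \<ge> 0")
        case True
        have "(m - e) * real N \<le> (m - e) * (c * real (?k n))"
          using True kS r unfolding c_def[symmetric] by (intro mult_left_mono) auto
        also have "\<dots> = c * ((m - e) * real (?k n))" by simp
        also have "\<dots> \<le> c * S N" using lo monoD[OF mono kn] c by (intro mult_left_mono) auto
        finally show ?thesis .
      next
        case False
        then have "(m - e) * real N \<le> 0" by (intro mult_nonpos_nonneg) auto
        moreover have "c * S N \<ge> 0" using c nn by simp
        ultimately show ?thesis by linarith
      qed
      then have "(m - e) / c \<le> S N / N" using N0 c by (simp add: field_simps)
      with A show ?thesis unfolding c_def by simp
    qed
    then show ?thesis by (auto simp: eventually_sequentially)
  qed
  show ?thesis
  proof (rule order_tendstoI)
    \<comment> \<open>One parameter serves for both the ratio \<open>1 + e q\<close> and the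
      tolerance \<open>e q\<close>, so that both bounds tend to \<open>m\<close> as \<open>q\<close>
      grows.\<close>
    define e where "e q = 1 / real (Suc q)" for q
    have e0: "e \<longlonglongrightarrow> 0" unfolding e_def using LIMSEQ_inverse_real_of_nat by (simp add: inverse_eq_divide)
    fix y
    { assume y: "y < m"
      have "(\<lambda>q. (m - e q) / ((1 + e q) * (1 + e q))) \<longlonglongrightarrow> (m - 0) / ((1 + 0) * (1 + 0))"
        by (intro tendsto_intros e0) auto
      then have "eventually (\<lambda>q. y < (m - e q) / ((1 + e q) * (1 + e q))) sequentially"
        using y by (intro order_tendstoD) auto
      then obtain q where q: "y < (m - e q) / ((1 + e q) * (1 + e q))"
        by (auto simp: eventually_sequentially)
      show "eventually (\<lambda>n. y < S n / real n) sequentially"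
        using bounds[of "e q" "1 + e q" q] by (rule eventually_mono[rotated 2]) (use q in \<open>auto simp: e_def\<close>) }
    { assume y: "m < y"
      have "(\<lambda>q. (1 + e q) * (1 + e q) * (m + e q)) \<longlonglongrightarrow> (1 + 0) * (1 + 0) * (m + 0)"
        by (intro tendsto_intros e0)
      then have "eventually (\<lambda>q. (1 + e q) * (1 + e q) * (m + e q) < y) sequentially"
        using y by (intro order_tendstoD) auto
      then obtain q where q: "(1 + e q) * (1 + e q) * (m + e q) < y"
        by (auto simp: eventually_sequentially)
      show "eventually (\<lambda>n. S n / real n < y) sequentially"
        using bounds[of "e q" "1 + e q" q] by (rule eventually_mono[rotated 2]) (use q in \<open>auto simp: e_def\<close>) }
  qed
qed

text \<open>Variances of independent variables add up, because the mixed products of the centred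
  variables have mean 0, and a variance is at most the second moment. The bound \<open>B\<close>
  makes all products integrable.\<close>

lemma (in prob_space) second_moment_sum_indep:
  fixes Z :: "nat \<Rightarrow> 'a \<Rightarrow> real"
  assumes ind: "indep_vars (\<lambda>_. borel) Z UNIV" and bd: "\<And>i x. \<bar>Z i x\<bar> \<le> B"
  shows "integrable M (\<lambda>x. (\<Sum>i<n. Z i x - expectation (Z i))\<^sup>2)"
    and "expectation (\<lambda>x. (\<Sum>i<n. Z i x - expectation (Z i))\<^sup>2) \<le> (\<Sum>i<n. expectation (\<lambda>x. (Z i x)\<^sup>2))"
proof -
  have [measurable]: "Z i \<in> borel_measurable M" for i
    using ind by (auto simp: indep_vars_def)
  define W where "W i x = Z i x - expectation (Z i)" for i x
  have intZ: "integrable M (Z i)" for i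
    by (rule integrable_const_bound[where B = B]) (use bd in auto)
  have [measurable]: "W i \<in> borel_measurable M" for i
    unfolding W_def by measurable
  have intZ2: "integrable M (\<lambda>x. (Z i x)\<^sup>2)" for i
  proof (rule integrable_const_bound[where B = "B\<^sup>2"])
    show "AE x in M. norm ((Z i x)\<^sup>2) \<le> B\<^sup>2"
    proof (rule AE_I2)
      fix x
      show "norm ((Z i x)\<^sup>2) \<le> B\<^sup>2" using power_mono[OF bd[of i x] abs_ge_zero, of 2] by simp
    qed
  qed simp
  have bdW: "\<bar>W i x\<bar> \<le> B + \<bar>expectation (Z i)\<bar>" for i x
    unfolding W_def using bd[of i x] by linarith
  have intW: "integrable M (\<lambda>x. W i x * W j x)" for i j
  proof (rule integrable_const_bound[where B = "(B + \<bar>expectation (Z i)\<bar>) * (B + \<bar>expectation (Z j)\<bar>)"])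
    have "\<bar>W i x * W j x\<bar> \<le> (B + \<bar>expectation (Z i)\<bar>) * (B + \<bar>expectation (Z j)\<bar>)" for x
      unfolding abs_mult using bdW[of i x] by (intro mult_mono bdW) auto
    then show "AE x in M. norm (W i x * W j x) \<le> (B + \<bar>expectation (Z i)\<bar>) * (B + \<bar>expectation (Z j)\<bar>)"
      by simp
  qed simp
  have intW1: "integrable M (W i)" and EW: "expectation (W i) = 0" for i
    unfolding W_def using intZ by (simp_all add: prob_space)
  have indW: "indep_vars (\<lambda>_. borel) W UNIV"
    unfolding W_def by (rule indep_vars_compose2[OF ind]) simp
  have E0: "expectation (\<lambda>x. W i x * W j x) = 0" if "i \<noteq> j" for i j
    using indep_vars_lebesgue_integral[of "{i, j}" W] indep_vars_subset[OF indW, of "{i, j}"]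
      that intW1 EW by simp
  have sq: "(\<Sum>i<n. W i x)\<^sup>2 = (\<Sum>i<n. \<Sum>j<n. W i x * W j x)" for x
    by (simp add: power2_eq_square sum_product)
  show "integrable M (\<lambda>x. (\<Sum>i<n. Z i x - expectation (Z i))\<^sup>2)"
    unfolding W_def[symmetric] sq using intW by (intro Bochner_Integration.integrable_sum)
  have "expectation (\<lambda>x. (\<Sum>i<n. W i x)\<^sup>2) = (\<Sum>i<n. \<Sum>j<n. expectation (\<lambda>x. W i x * W j x))"
    unfolding sq using intW by (simp add: Bochner_Integration.integral_sum)
  also have "\<dots> = (\<Sum>i<n. \<Sum>j<n. if j = i then expectation (\<lambda>x. W i x * W i x) else 0)"
    by (intro sum.cong refl) (auto simp: E0)
  also have "\<dots> = (\<Sum>i<n. expectation (\<lambda>x. (W i x)\<^sup>2))"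
    by (simp add: power2_eq_square)
  also have "\<dots> \<le> (\<Sum>i<n. expectation (\<lambda>x. (Z i x)\<^sup>2))"
    unfolding W_def using intZ intZ2 by (intro sum_mono) (simp add: variance_eq)
  finally show "expectation (\<lambda>x. (\<Sum>i<n. Z i x - expectation (Z i))\<^sup>2) \<le> (\<Sum>i<n. expectation (\<lambda>x. (Z i x)\<^sup>2))"
    unfolding W_def .
qed

section \<open>Etemadi's proof of the strong law\<close>

lemma distr_eq_integral:
  fixes g :: "'b \<Rightarrow> 'c::{banach, second_countable_topology}"
  assumes "distr M N X = distr M N Y" "X \<in> measurable M N" "Y \<in> measurable M N"
    and "g \<in> borel_measurable N"
  shows "integral\<^sup>L M (\<lambda>x. g (X x)) = integral\<^sup>L M (\<lambda>x. g (Y x))"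
    and "integrable M (\<lambda>x. g (X x)) \<longleftrightarrow> integrable M (\<lambda>x. g (Y x))"
  using assms integral_distr[of X M N g] integral_distr[of Y M N g]
    integrable_distr_eq[of X M N g] integrable_distr_eq[of Y M N g] by simp_all

text \<open>All summands of the \<open>n\<close>-th partial sum are truncated at the common level \<open>geom_index a n\<close>
  (Etemadi truncates the \<open>i\<close>-th one at \<open>i\<close>), so that the truncation errors and the variances are
  both controlled by geometric sums.\<close>

lemma (in prob_space) etemadi_subsequence:
  fixes X :: "nat \<Rightarrow> 'a \<Rightarrow> real"
  assumes ind: "indep_vars (\<lambda>_. borel) X UNIV" and nn: "\<And>i x. X i x \<ge> 0"
    and id: "\<And>i. distr M borel (X i) = distr M borel Y"
    and Y: "integrable M Y" "\<And>x. Y x \<ge> 0" and a: "a > 1"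
  shows "AE x in M. (\<lambda>n. (\<Sum>i<geom_index a n. X i x) / real (geom_index a n)) \<longlonglongrightarrow> expectation Y"
proof -
  have X[measurable]: "X i \<in> borel_measurable M" for i
    using ind by (auto simp: indep_vars_def)
  have Ym[measurable]: "Y \<in> borel_measurable M" using Y by auto
  note k = geom_index_bounds[OF a]
  let ?k = "geom_index a"
  define C where "C = 2 * a / (a - 1) * expectation Y"
  define t :: "nat \<Rightarrow> real \<Rightarrow> real" where "t n y = (if y \<le> real (?k n) then y else 0)" for n y
  have [measurable]: "t n \<in> borel_measurable borel" for n
    unfolding t_def by measurable
  have bdt: "\<bar>t n y\<bar> \<le> real (?k n)" if "y \<ge> 0" for n y using that by (auto simp: t_def)
  note tr = distr_eq_integral[OF id X Ym]

  \<comment> \<open>This sum counts the summands that the truncation changes. Its mean is the level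
    times the probability that \<open>Y\<close> exceeds the level, and these means have partial sums
    at most \<open>C\<close> by \<open>geom_index_sum_below\<close>.\<close>
  have "AE x in M. (\<lambda>n. \<Sum>i<?k n. indicator {real (?k n)<..} (X i x)) \<longlonglongrightarrow> (0::real)"
  proof (rule AE_tendsto_zero_if_integrals_summable[where C = C])
    have intI: "integrable M (\<lambda>x. indicator {real (?k n)<..} (X i x) :: real)" for i n
      by (rule integrable_const_bound[where B = 1]) (auto split: split_indicator)
    have intIY: "integrable M (\<lambda>x. indicator {real (?k n)<..} (Y x) :: real)" for n
      by (rule integrable_const_bound[where B = 1]) (auto split: split_indicator)
    show "integrable M (\<lambda>x. \<Sum>i<?k n. indicator {real (?k n)<..} (X i x) :: real)" for n
      using intI by (intro Bochner_Integration.integrable_sum)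
    show "0 \<le> (\<Sum>i<?k n. indicator {real (?k n)<..} (X i x) :: real)" for n x
      by (intro sum_nonneg) auto
    fix N
    have "expectation (\<lambda>x. \<Sum>i<?k n. indicator {real (?k n)<..} (X i x) :: real)
       = expectation (\<lambda>x. if real (?k n) < Y x then real (?k n) else 0)" for n
    proof -
      have "expectation (\<lambda>x. \<Sum>i<?k n. indicator {real (?k n)<..} (X i x) :: real)
        = (\<Sum>i<?k n. expectation (\<lambda>x. indicator {real (?k n)<..} (X i x)))"
        using intI by (rule Bochner_Integration.integral_sum)
      also have "\<dots> = (\<Sum>i<?k n. expectation (\<lambda>x. indicator {real (?k n)<..} (Y x)))"
        by (intro sum.cong refl tr(1)) auto
      also have "\<dots> = expectation (\<lambda>x. real (?k n) * indicator {real (?k n)<..} (Y x))"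
        by simp
      also have "\<dots> = expectation (\<lambda>x. if real (?k n) < Y x then real (?k n) else 0)"
        by (intro Bochner_Integration.integral_cong) (auto split: split_indicator)
      finally show ?thesis .
    qed
    then have "(\<Sum>n<N. expectation (\<lambda>x. \<Sum>i<?k n. indicator {real (?k n)<..} (X i x) :: real))
      = (\<Sum>n<N. expectation (\<lambda>x. if real (?k n) < Y x then real (?k n) else 0))"
      by simp
    also have "\<dots> = expectation (\<lambda>x. \<Sum>n<N. if real (?k n) < Y x then real (?k n) else 0)"
    proof (rule Bochner_Integration.integral_sum[symmetric])
      show "integrable M (\<lambda>x. if real (?k n) < Y x then real (?k n) else 0)" for n
        by (rule integrable_const_bound[where B = "real (?k n)"]) simp_all
    qed
    also have "\<dots> \<le> expectation (\<lambda>x. 2 * a / (a - 1) * Y x)"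
      using Y geom_index_sum_below[OF a]
        a by (intro integral_mono' integrable_mult_right) simp_all
    also have "\<dots> = C" using Y by (simp add: C_def)
    finally show "(\<Sum>n<N. expectation (\<lambda>x. \<Sum>i<?k n. indicator {real (?k n)<..} (X i x) :: real)) \<le> C" .
  qed
  then have A: "AE x in M. eventually (\<lambda>n. (\<Sum>i<?k n. X i x) = (\<Sum>i<?k n. t n (X i x))) sequentially"
  proof eventually_elim
    case (elim x)
    \<comment> \<open>The count is an integer, so a value below 1 means that no summand is
      truncated.\<close>
    then have "eventually (\<lambda>n. (\<Sum>i<?k n. indicator {real (?k n)<..} (X i x)) < (1::real)) sequentially"
      by (rule order_tendstoD) simp
    then show ?case
    proof eventually_elim
      case (elim n)
      have "X i x \<le> real (?k n)" if "i < ?k n" for i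
      proof (rule ccontr)
        assume "\<not> X i x \<le> real (?k n)"
        then have "1 = (indicator {real (?k n)<..} (X i x) :: real)" by simp
        also have "\<dots> \<le> (\<Sum>i<?k n. indicator {real (?k n)<..} (X i x))"
          using that by (intro member_le_sum) auto
        finally show False using elim by simp
      qed
      then show ?case by (intro sum.cong) (auto simp: t_def)
    qed
  qed

  have intt: "integrable M (\<lambda>x. t n (Y x))" for n
    by (rule integrable_const_bound[where B = "real (?k n)"]) (use bdt Y in auto)
  have intt2: "integrable M (\<lambda>x. (t n (Y x))\<^sup>2)" for n
  proof (rule integrable_const_bound[where B = "(real (?k n))\<^sup>2"])
    show "AE x in M. norm ((t n (Y x))\<^sup>2) \<le> (real (?k n))\<^sup>2"
    proof (rule AE_I2)
      fix x
      show "norm ((t n (Y x))\<^sup>2) \<le> (real (?k n))\<^sup>2"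
        using power_mono[OF bdt[OF Y(2)[of x], of n] abs_ge_zero, of 2] by simp
    qed
  qed simp
  \<comment> \<open>The squared deviation of the truncated average from its mean. Independence
    bounds its expectation by the truncated second moment over the level, and the sum of these
    bounds is at most \<open>C\<close> by \<open>geom_index_sum_above\<close>.\<close>
  define f where "f n x = ((\<Sum>i<?k n. t n (X i x) - expectation (\<lambda>x. t n (X i x))) / real (?k n))\<^sup>2" for n x
  have ind_t: "indep_vars (\<lambda>_. borel) (\<lambda>i x. t n (X i x)) UNIV" for n
    by (rule indep_vars_compose2[OF ind]) simp
  note sm = second_moment_sum_indep[OF ind_t, of _ "real (?k _)", OF bdt[OF nn]]
  have "AE x in M. (\<lambda>n. f n x) \<longlonglongrightarrow> 0"
  proof (rule AE_tendsto_zero_if_integrals_summable[where C = C])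
    show "integrable M (f n)" for n
      unfolding f_def power_divide using sm(1) by (intro integrable_divide)
    show "0 \<le> f n x" for n x by (simp add: f_def)
    have Ef: "expectation (f n) \<le> expectation (\<lambda>x. (t n (Y x))\<^sup>2 / real (?k n))" for n
    proof -
      have "expectation (f n) \<le> (\<Sum>i<?k n. expectation (\<lambda>x. (t n (X i x))\<^sup>2)) / (real (?k n))\<^sup>2"
        unfolding f_def power_divide using sm(2) by (simp add: divide_right_mono)
      also have "\<dots> = (\<Sum>i<?k n. expectation (\<lambda>x. (t n (Y x))\<^sup>2)) / (real (?k n))\<^sup>2"
        by (intro arg_cong2[where f = "(/)"] sum.cong refl tr(1)) auto
      also have "\<dots> = expectation (\<lambda>x. (t n (Y x))\<^sup>2 / real (?k n))"
        using k(4)[of n] by (simp add: power2_eq_square)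
      finally show ?thesis .
    qed
    fix N
    have "(\<Sum>n<N. expectation (f n)) \<le> (\<Sum>n<N. expectation (\<lambda>x. (t n (Y x))\<^sup>2 / real (?k n)))"
      by (intro sum_mono Ef)
    also have "\<dots> = expectation (\<lambda>x. \<Sum>n<N. (t n (Y x))\<^sup>2 / real (?k n))"
      using intt2 by (intro Bochner_Integration.integral_sum[symmetric]) auto
    also have "\<dots> \<le> expectation (\<lambda>x. 2 * a / (a - 1) * Y x)"
    proof (rule integral_mono')
      fix x
      have "(\<Sum>n<N. (t n (Y x))\<^sup>2 / real (?k n)) = (\<Sum>n<N. if Y x \<le> real (?k n) then (Y x)\<^sup>2 / real (?k n) else 0)"
        by (intro sum.cong) (auto simp: t_def)
      also have "\<dots> \<le> 2 * a / (a - 1) * Y x" by (rule geom_index_sum_above[OF a Y(2)])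
      finally show "(\<Sum>n<N. (t n (Y x))\<^sup>2 / real (?k n)) \<le> 2 * a / (a - 1) * Y x" .
    qed (use Y a in auto)
    also have "\<dots> = C" using Y by (simp add: C_def)
    finally show "(\<Sum>n<N. expectation (f n)) \<le> C" .
  qed
  with A have A': "AE x in M. (\<lambda>n. f n x) \<longlonglongrightarrow> 0 \<and>
    eventually (\<lambda>n. (\<Sum>i<?k n. X i x) = (\<Sum>i<?k n. t n (X i x))) sequentially"
    by eventually_elim simp
  \<comment> \<open>The truncated averages approach means that still depend on \<open>n\<close>;
    these tend to \<open>expectation Y\<close> by dominated convergence.\<close>
  have mean: "(\<lambda>n. expectation (\<lambda>x. t n (Y x))) \<longlonglongrightarrow> expectation Y"
  proof (rule integral_dominated_convergence[where w = Y])
    show "AE x in M. (\<lambda>n. t n (Y x)) \<longlonglongrightarrow> Y x"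
    proof (rule AE_I2)
      fix x
      have "eventually (\<lambda>n. real (?k n) \<ge> Y x) sequentially"
        using geom_index_at_top[OF a] unfolding filterlim_at_top by blast
      then have "eventually (\<lambda>n. t n (Y x) = Y x) sequentially"
        by eventually_elim (simp add: t_def)
      then show "(\<lambda>n. t n (Y x)) \<longlonglongrightarrow> Y x" by (rule tendsto_eventually)
    qed
    show "AE x in M. norm (t n (Y x)) \<le> Y x" for n
      using Y(2) by (auto simp: t_def)
  qed (use Y in auto)
  from A' show ?thesis
  proof (eventually_elim)
    case (elim x)
    have "(\<lambda>n. sqrt (f n x)) \<longlonglongrightarrow> sqrt 0" using elim by (intro tendsto_real_sqrt) simp
    then have "(\<lambda>n. (\<Sum>i<?k n. t n (X i x) - expectation (\<lambda>x. t n (X i x))) / real (?k n)) \<longlonglongrightarrow> 0"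
      unfolding f_def real_sqrt_abs real_sqrt_zero by (rule tendsto_rabs_zero_cancel)
    from tendsto_add[OF this mean]
    have "(\<lambda>n. (\<Sum>i<?k n. t n (X i x) - expectation (\<lambda>x. t n (X i x))) / real (?k n) + expectation (\<lambda>x. t n (Y x)))
      \<longlonglongrightarrow> expectation Y" by simp
    moreover have "(\<Sum>i<?k n. t n (X i x) - expectation (\<lambda>x. t n (X i x))) / real (?k n) + expectation (\<lambda>x. t n (Y x))
      = (\<Sum>i<?k n. t n (X i x)) / real (?k n)" for n
    proof -
      have "expectation (\<lambda>x. t n (X i x)) = expectation (\<lambda>x. t n (Y x))" for i by (intro tr(1)) simp
      then show ?thesis using k(4)[of n] by (simp add: sum_subtractf field_simps)
    qed
    ultimately have "(\<lambda>n. (\<Sum>i<?k n. t n (X i x)) / real (?k n)) \<longlonglongrightarrow> expectation Y" by simp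
    then show ?case
      by (rule Lim_transform_eventually) (use conjunct2[OF elim] in \<open>eventually_elim, simp\<close>)
  qed
qed

text \<open>Nonnegativity makes the partial sums monotone in \<open>n\<close>, so convergence along
  the rounded powers of countably many ratios suffices.\<close>

lemma (in prob_space) strong_law_nonneg:
  fixes X :: "nat \<Rightarrow> 'a \<Rightarrow> real"
  assumes ind: "indep_vars (\<lambda>_. borel) X UNIV" and nn: "\<And>i x. X i x \<ge> 0"
    and id: "\<And>i. distr M borel (X i) = distr M borel Y"
    and Y: "integrable M Y" "\<And>x. Y x \<ge> 0"
  shows "AE x in M. (\<lambda>n. (\<Sum>i<n. X i x) / real n) \<longlonglongrightarrow> expectation Y"
proof -
  have "AE x in M. \<forall>q. (\<lambda>n. (\<Sum>i<geom_index (1 + 1 / real (Suc q)) n. X i x)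
    / real (geom_index (1 + 1 / real (Suc q)) n)) \<longlonglongrightarrow> expectation Y"
    unfolding AE_all_countable by (intro allI etemadi_subsequence assms) simp
  then show ?thesis
  proof eventually_elim
    case (elim x)
    show ?case
    proof (rule averages_tendsto_if_along_geom_index)
      show "mono (\<lambda>n. \<Sum>i<n. X i x)" using nn by (intro monoI sum_mono2) auto
      show "(\<Sum>i<n. X i x) \<ge> 0" for n using nn by (intro sum_nonneg)
    qed (use elim in blast)
  qed
qed

text \<open>Adding \<open>B\<close> to every variable reduces this to the nonnegative case.\<close>

lemma (in prob_space) strong_law_bounded:
  fixes X :: "nat \<Rightarrow> 'a \<Rightarrow> real"
  assumes ind: "indep_vars (\<lambda>_. borel) X UNIV" and bd: "\<And>i x. \<bar>X i x\<bar> \<le> B" "\<And>x. \<bar>Y x\<bar> \<le> B"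
    and id: "\<And>i. distr M borel (X i) = distr M borel Y"
    and Y[measurable]: "Y \<in> borel_measurable M"
  shows "AE x in M. (\<lambda>n. (\<Sum>i<n. X i x) / real n) \<longlonglongrightarrow> expectation Y"
proof -
  have X[measurable]: "X i \<in> borel_measurable M" for i
    using ind by (auto simp: indep_vars_def)
  have intY: "integrable M Y"
    by (rule integrable_const_bound[where B = B]) (use bd in auto)
  have "AE x in M. (\<lambda>n. (\<Sum>i<n. X i x + B) / real n) \<longlonglongrightarrow> expectation (\<lambda>x. Y x + B)"
  proof (rule strong_law_nonneg)
    show "indep_vars (\<lambda>_. borel) (\<lambda>i x. X i x + B) UNIV"
      by (rule indep_vars_compose2[OF ind]) simp
    show "X i x + B \<ge> 0" for i x using bd(1)[of i x] by linarith
    show "Y x + B \<ge> 0" for x using bd(2)[of x] by linarith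
    show "distr M borel (\<lambda>x. X i x + B) = distr M borel (\<lambda>x. Y x + B)" for i
    proof -
      have "distr (distr M borel (X i)) borel (\<lambda>y. y + B) = distr (distr M borel Y) borel (\<lambda>y. y + B)"
        by (simp add: id)
      then show ?thesis by (simp add: distr_distr comp_def)
    qed
  qed (use intY in auto)
  then show ?thesis
  proof eventually_elim
    case (elim x)
    have "(\<lambda>n. (\<Sum>i<n. X i x + B) / real n - B) \<longlonglongrightarrow> expectation (\<lambda>x. Y x + B) - B"
      by (intro tendsto_intros elim)
    then have "(\<lambda>n. (\<Sum>i<n. X i x + B) / real n - B) \<longlonglongrightarrow> expectation Y"
      using intY by (simp add: prob_space)
    \<comment> \<open>The restriction to positive \<open>n\<close> matters: at \<open>n = 0\<close>
      both quotients are 0 and the left side is \<open>- B\<close>.\<close>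
    moreover have "eventually (\<lambda>n. (\<Sum>i<n. X i x + B) / real n - B = (\<Sum>i<n. X i x) / real n) sequentially"
      using eventually_gt_at_top[of 0] by eventually_elim (simp add: sum.distrib field_simps)
    ultimately show ?case by (rule Lim_transform_eventually)
  qed
qed

subsection \<open>Levy measures and characteristic functions\<close>

text \<open>Dominated convergence with varying majorants. Cutting \<open>u n\<close> off at
  \<open>g'\<close> gives functions to which the usual theorem applies. The part cut off is at most
  the positive part of \<open>g n - g'\<close>, that is, \<open>g n - g'\<close> plus the positive
  part of \<open>g' - g n\<close>. The first integral tends to 0 by assumption, the second by
  dominated convergence, since \<open>g n\<close> is nonnegative.\<close>

lemma integral_tendsto_if_dominating_integrals_tendsto:
  fixes u g :: "nat \<Rightarrow> 'a \<Rightarrow> real"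
  assumes u: "\<And>n. u n \<in> borel_measurable M" "u' \<in> borel_measurable M"
    and g: "\<And>n. integrable M (g n)" "integrable M g'"
    and bd: "\<And>n x. 0 \<le> u n x" "\<And>n x. u n x \<le> g n x"
    and lim: "AE x in M. (\<lambda>n. u n x) \<longlonglongrightarrow> u' x" "AE x in M. (\<lambda>n. g n x) \<longlonglongrightarrow> g' x"
    and int_lim: "(\<lambda>n. integral\<^sup>L M (g n)) \<longlonglongrightarrow> integral\<^sup>L M g'"
  shows "(\<lambda>n. integral\<^sup>L M (u n)) \<longlonglongrightarrow> integral\<^sup>L M u'"
proof -
  note [measurable] = u
  have [measurable]: "g n \<in> borel_measurable M" "g' \<in> borel_measurable M" for n using g by auto
  have intu: "integrable M (u n)" for n
    by (rule Bochner_Integration.integrable_bound[OF g(1)[of n]])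
       (use bd order_trans[OF bd] in \<open>auto simp: abs_of_nonneg\<close>)
  have lim': "AE x in M. (\<lambda>n. u n x) \<longlonglongrightarrow> u' x \<and> (\<lambda>n. g n x) \<longlonglongrightarrow> g' x \<and> 0 \<le> g' x \<and> u' x \<le> g' x"
    using lim
  proof eventually_elim
    case (elim x)
    then show ?case
      using bd by (auto intro: LIMSEQ_le LIMSEQ_le_const[of "\<lambda>n. g n x"] order_trans[OF bd])
  qed
  have A: "(\<lambda>n. \<integral>x. min (u n x) (g' x) \<partial>M) \<longlonglongrightarrow> integral\<^sup>L M u'"
  proof (rule integral_dominated_convergence[where w = g'])
    show "AE x in M. (\<lambda>n. min (u n x) (g' x)) \<longlonglongrightarrow> u' x"
      using lim'
    proof eventually_elim
      case (elim x)
      then have "(\<lambda>n. min (u n x) (g' x)) \<longlonglongrightarrow> min (u' x) (g' x)" by (intro tendsto_min) auto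
      with elim show ?case by (simp add: min_absorb1)
    qed
    show "AE x in M. norm (min (u n x) (g' x)) \<le> g' x" for n
      using lim' by eventually_elim (use bd in auto)
  qed (use g in auto)
  have B: "(\<lambda>n. \<integral>x. max 0 (g' x - g n x) \<partial>M) \<longlonglongrightarrow> (\<integral>x. 0 \<partial>M)"
  proof (rule integral_dominated_convergence[where w = g'])
    show "AE x in M. (\<lambda>n. max 0 (g' x - g n x)) \<longlonglongrightarrow> 0"
      using lim'
    proof eventually_elim
      case (elim x)
      then have "(\<lambda>n. max 0 (g' x - g n x)) \<longlonglongrightarrow> max 0 (g' x - g' x)" by (intro tendsto_intros) auto
      then show ?case by simp
    qed
    show "AE x in M. norm (max 0 (g' x - g n x)) \<le> g' x" for n
      using lim' by eventually_elim (use order_trans[OF bd, of n] in auto)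
  qed (use g in auto)
  have C: "(\<lambda>n. (integral\<^sup>L M (g n) - integral\<^sup>L M g') + (\<integral>x. max 0 (g' x - g n x) \<partial>M)) \<longlonglongrightarrow> 0"
    using tendsto_add[OF tendsto_diff[OF int_lim tendsto_const[of "integral\<^sup>L M g'"]] B] by simp
  have D: "\<bar>integral\<^sup>L M (u n) - (\<integral>x. min (u n x) (g' x) \<partial>M)\<bar>
    \<le> (integral\<^sup>L M (g n) - integral\<^sup>L M g') + (\<integral>x. max 0 (g' x - g n x) \<partial>M)" for n
  proof -
    have "integral\<^sup>L M (u n) - (\<integral>x. min (u n x) (g' x) \<partial>M) = (\<integral>x. u n x - min (u n x) (g' x) \<partial>M)"
      using intu g by simp
    moreover have "0 \<le> (\<integral>x. u n x - min (u n x) (g' x) \<partial>M)"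
      by (intro integral_nonneg_AE) auto
    moreover have "(\<integral>x. u n x - min (u n x) (g' x) \<partial>M) \<le> (\<integral>x. (g n x - g' x) + max 0 (g' x - g n x) \<partial>M)"
    proof (intro integral_mono)
      show "u n x - min (u n x) (g' x) \<le> g n x - g' x + max 0 (g' x - g n x)" for x
        using bd(2)[of n x] by (auto simp: min_def max_def)
    qed (use intu g in auto)
    ultimately show ?thesis using g by simp
  qed
  have "(\<lambda>n. integral\<^sup>L M (u n) - (\<integral>x. min (u n x) (g' x) \<partial>M)) \<longlonglongrightarrow> 0"
    by (rule Lim_null_comparison[OF _ C]) (use D in auto)
  from tendsto_add[OF this A] show ?thesis by simp
qed

text \<open>Convergence is expressed with countable quantifiers only. This measurability is what the
  exchange of two almost-everywhere quantifiers requires.\<close>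

lemma sets_Collect_tendsto:
  fixes f :: "nat \<Rightarrow> 'a \<Rightarrow> 'b::{metric_space, second_countable_topology}"
  assumes [measurable]: "\<And>n. f n \<in> borel_measurable M" "f' \<in> borel_measurable M"
  shows "{x \<in> space M. (\<lambda>n. f n x) \<longlonglongrightarrow> f' x} \<in> sets M"
proof -
  have "(\<lambda>n. f n x) \<longlonglongrightarrow> f' x \<longleftrightarrow> (\<forall>k. \<exists>n0. \<forall>n\<ge>n0. dist (f n x) (f' x) < inverse (real (Suc k)))" for x
  proof
    assume "(\<lambda>n. f n x) \<longlonglongrightarrow> f' x"
    then show "\<forall>k. \<exists>n0. \<forall>n\<ge>n0. dist (f n x) (f' x) < inverse (real (Suc k))"
      unfolding lim_sequentially by (metis inverse_positive_iff_positive of_nat_0_less_iff zero_less_Suc)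
  next
    assume *: "\<forall>k. \<exists>n0. \<forall>n\<ge>n0. dist (f n x) (f' x) < inverse (real (Suc k))"
    show "(\<lambda>n. f n x) \<longlonglongrightarrow> f' x"
      unfolding lim_sequentially
    proof (intro allI impI)
      fix r :: real assume "r > 0"
      then obtain k where "inverse (real (Suc k)) < r" using reals_Archimedean by blast
      with * show "\<exists>n0. \<forall>n\<ge>n0. dist (f n x) (f' x) < r" by (meson less_trans)
    qed
  qed
  then show ?thesis by simp
qed

lemma Cauchy_Schwarz_integral:
  fixes f g :: "'a \<Rightarrow> real"
  assumes "integrable M (\<lambda>x. (f x)\<^sup>2)" "integrable M (\<lambda>x. (g x)\<^sup>2)" "integrable M (\<lambda>x. f x * g x)"
    and [measurable]: "f \<in> borel_measurable M" "g \<in> borel_measurable M"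
    and nn: "\<And>x. f x \<ge> 0" "\<And>x. g x \<ge> 0"
  shows "(\<integral>x. f x * g x \<partial>M)\<^sup>2 \<le> (\<integral>x. (f x)\<^sup>2 \<partial>M) * (\<integral>x. (g x)\<^sup>2 \<partial>M)"
proof -
  have "(\<integral>\<^sup>+x. ennreal (f x) * ennreal (g x) \<partial>M)\<^sup>2
    \<le> (\<integral>\<^sup>+x. (ennreal (f x))\<^sup>2 \<partial>M) * (\<integral>\<^sup>+x. (ennreal (g x))\<^sup>2 \<partial>M)"
    by (rule Cauchy_Schwarz_nn_integral) auto
  also have "(\<integral>\<^sup>+x. ennreal (f x) * ennreal (g x) \<partial>M) = ennreal (\<integral>x. f x * g x \<partial>M)"
    using nn assms by (simp add: nn_integral_eq_integral flip: ennreal_mult)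
  also have "(\<integral>\<^sup>+x. (ennreal (f x))\<^sup>2 \<partial>M) = ennreal (\<integral>x. (f x)\<^sup>2 \<partial>M)"
    using nn assms by (simp add: nn_integral_eq_integral ennreal_power)
  also have "(\<integral>\<^sup>+x. (ennreal (g x))\<^sup>2 \<partial>M) = ennreal (\<integral>x. (g x)\<^sup>2 \<partial>M)"
    using nn assms by (simp add: nn_integral_eq_integral ennreal_power)
  finally show ?thesis
    using nn by (simp add: ennreal_power integral_nonneg_AE flip: ennreal_mult)
qed

lemma one_minus_cos_le: "1 - cos (u::real) \<le> u\<^sup>2 / 2"
proof -
  have "1 - cos u = 2 * (sin (u / 2))\<^sup>2"
    using cos_double_sin[of "u / 2"] by simp
  also have "\<dots> \<le> 2 * (u / 2)\<^sup>2"
    using abs_sin_x_le_abs_x[of "u / 2"] by (simp only: abs_le_square_iff mult_left_mono)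
  finally show ?thesis by (simp add: power_divide)
qed

section \<open>Symmetric Levy measures and the functions they define\<close>

locale sym_levy =
  fixes \<mu> :: "'a::euclidean_space measure"
  assumes levy: "sym_levy_measure \<mu>"
begin

lemma sets_levy[measurable_cong, simp]: "sets \<mu> = sets borel"
  and emeasure_zero: "emeasure \<mu> {0} = 0"
  and levy_integral_finite: "(\<integral>\<^sup>+ r. ennreal (min 1 (norm r ^ 2)) \<partial>\<mu>) < \<infinity>"
  using levy by (auto simp: sym_levy_measure_def)

lemma space_levy[simp]: "space \<mu> = UNIV"
  using sets_eq_imp_space_eq[OF sets_levy] by simp

sublocale sigma_finite_measure \<mu>
proof
  \<comment> \<open>The points where \<open>min 1 ((norm x)\<^sup>2)\<close> is at least
    \<open>1 / Suc n\<close>. They have finite measure by Markov's inequality and exhaust everything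
    but the origin, which is a null set.\<close>
  define A where "A n = {x \<in> UNIV. 1 \<le> ennreal (real (Suc n)) * ennreal (min 1 ((norm (x::'a))\<^sup>2))}" for n
  have [measurable]: "A n \<in> sets borel" for n unfolding A_def by measurable
  have fin: "emeasure \<mu> (A n) < \<infinity>" for n
  proof -
    have "emeasure \<mu> (A n) \<le> ennreal (real (Suc n)) * (\<integral>\<^sup>+ r. ennreal (min 1 (norm r ^ 2)) * indicator UNIV r \<partial>\<mu>)"
      unfolding A_def by (rule nn_integral_Markov_inequality) auto
    also have "\<dots> < \<infinity>" using levy_integral_finite by (simp add: ennreal_mult_less_top)
    finally show ?thesis .
  qed
  have cover: "\<exists>n. x \<in> A n" if "x \<noteq> 0" for x
  proof -
    have "min 1 ((norm x)\<^sup>2) > 0" using that by simp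
    then obtain n where "inverse (real (Suc n)) < min 1 ((norm x)\<^sup>2)" using reals_Archimedean by blast
    then have "1 \<le> real (Suc n) * min 1 ((norm x)\<^sup>2)"
      using mult_left_mono[of "inverse (real (Suc n))" "min 1 ((norm x)\<^sup>2)" "real (Suc n)"]
      by (simp del: of_nat_Suc)
    then have "1 \<le> ennreal (real (Suc n) * min 1 ((norm x)\<^sup>2))" by (metis ennreal_1 ennreal_leI)
    then show ?thesis unfolding A_def by (auto simp: ennreal_mult simp del: of_nat_Suc)
  qed
  show "\<exists>A. countable A \<and> A \<subseteq> sets \<mu> \<and> \<Union> A = space \<mu> \<and> (\<forall>a\<in>A. emeasure \<mu> a \<noteq> \<infinity>)"
    using cover fin emeasure_zero
    by (intro exI[of _ "insert {0} (range A)"]) (auto simp: less_top)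
qed

text \<open>The function is at most 2 everywhere and at most quadratic near the origin. The factor
  \<open>2 + (norm x)\<^sup>2\<close> is large enough for both regimes.\<close>

lemma integrable_one_minus_cos: "integrable \<mu> (\<lambda>s. 1 - cos (x \<bullet> s))"
proof -
  have "integrable \<mu> (\<lambda>r. min 1 ((norm r)\<^sup>2))"
    using levy_integral_finite by (intro integrableI_nonneg) auto
  then have "integrable \<mu> (\<lambda>r. (2 + (norm x)\<^sup>2) * min 1 ((norm r)\<^sup>2))" by simp
  then show ?thesis
  proof (rule Bochner_Integration.integrable_bound)
    have "1 - cos (x \<bullet> s) \<le> (2 + (norm x)\<^sup>2) * min 1 ((norm s)\<^sup>2)" for s
    proof (cases "1 \<le> (norm s)\<^sup>2")
      case True
      have "1 - cos (x \<bullet> s) \<le> 2" using cos_ge_minus_one[of "x \<bullet> s"] by linarith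
      with True show ?thesis by (simp add: min_absorb1 add_increasing2)
    next
      case False
      have "1 - cos (x \<bullet> s) \<le> (x \<bullet> s)\<^sup>2 / 2" by (rule one_minus_cos_le)
      also have "\<dots> \<le> (x \<bullet> s)\<^sup>2" by simp
      also have "\<dots> \<le> (norm x * norm s)\<^sup>2"
        using power_mono[OF Cauchy_Schwarz_ineq2[of x s] abs_ge_zero, of 2] by simp
      also have "\<dots> \<le> (2 + (norm x)\<^sup>2) * (norm s)\<^sup>2" by (simp add: power_mult_distrib algebra_simps)
      finally show ?thesis using False by (simp add: min_absorb2)
    qed
    then show "AE s in \<mu>. norm (1 - cos (x \<bullet> s)) \<le> norm ((2 + (norm x)\<^sup>2) * min 1 ((norm s)\<^sup>2))"
      by (auto intro!: AE_I2 order_trans[OF _ abs_ge_self])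
  qed simp
qed

lemma levy_fun_nonneg: "levy_fun \<mu> x \<ge> 0"
  unfolding levy_fun_def by (intro integral_nonneg_AE) auto

lemma nn_integral_one_minus_cos: "(\<integral>\<^sup>+ s. ennreal (1 - cos (x \<bullet> s)) \<partial>\<mu>) = ennreal (levy_fun \<mu> x)"
  unfolding levy_fun_def by (intro nn_integral_eq_integral integrable_one_minus_cos) auto

lemma levy_fun_measurable[measurable]: "levy_fun \<mu> \<in> borel_measurable borel"
  unfolding levy_fun_def[abs_def] by measurable

text \<open>Symmetry says that the image of \<open>\<mu>\<close> under negation is
  \<open>\<mu>\<close> itself.\<close>

lemma nn_integral_reflect:
  assumes [measurable]: "f \<in> borel_measurable borel"
  shows "(\<integral>\<^sup>+ s. f (- s) \<partial>\<mu>) = (\<integral>\<^sup>+ s. f s \<partial>\<mu>)"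
proof -
  have "distr \<mu> borel uminus = \<mu>"
  proof (rule measure_eqI)
    fix A assume "A \<in> sets (distr \<mu> borel uminus)"
    then have [measurable]: "A \<in> sets borel" by simp
    have "emeasure (distr \<mu> borel uminus) A = emeasure \<mu> (uminus -` A)"
      by (simp add: emeasure_distr)
    also have "uminus -` A = uminus ` A" by force
    also have "emeasure \<mu> (uminus ` A) = emeasure \<mu> A"
      using levy by (simp add: sym_levy_measure_def)
    finally show "emeasure (distr \<mu> borel uminus) A = emeasure \<mu> A" .
  qed simp
  then have "(\<integral>\<^sup>+ s. f s \<partial>\<mu>) = (\<integral>\<^sup>+ s. f s \<partial>distr \<mu> borel uminus)" by simp
  also have "\<dots> = (\<integral>\<^sup>+ s. f (- s) \<partial>\<mu>)" by (simp add: nn_integral_distr)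
  finally show ?thesis by simp
qed

end

section \<open>Characteristic functions and their integrals against Levy measures\<close>

context prob_space
begin

lemma integrable_cis:
  assumes [measurable]: "f \<in> borel_measurable M"
  shows "integrable M (\<lambda>\<omega>. cis (f \<omega>))"
  by (rule integrable_const_bound[where B = 1]) (auto simp: cis_conv_exp)

lemma charf_measurable[measurable]:
  fixes X :: "'a \<Rightarrow> 'b::euclidean_space"
  assumes [measurable]: "X \<in> borel_measurable M"
  shows "charf M X \<in> borel_measurable borel"
  unfolding charf_def[abs_def] cis_conv_exp by measurable

text \<open>Viewing the pair as one random vector makes measurability and convergence of
  \<open>charf\<close> available for the joint characteristic function.\<close>

lemma joint_charf_eq_charf: "joint_charf M X Y s t = charf M (\<lambda>\<omega>. (X \<omega>, Y \<omega>)) (s, t)"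
  by (simp add: joint_charf_def charf_def)

lemma Re_charf:
  assumes [measurable]: "X \<in> borel_measurable M"
  shows "Re (charf M X s) = expectation (\<lambda>\<omega>. cos (s \<bullet> X \<omega>))"
    and "Re (charf M X s) \<le> 1"
proof -
  have "integrable M (\<lambda>\<omega>. cis (s \<bullet> X \<omega>))" by (rule integrable_cis) measurable
  then show *: "Re (charf M X s) = expectation (\<lambda>\<omega>. cos (s \<bullet> X \<omega>))"
    unfolding charf_def by (subst integral_Re[symmetric]) auto
  have "expectation (\<lambda>\<omega>. cos (s \<bullet> X \<omega>)) \<le> expectation (\<lambda>\<omega>. 1)"
    by (intro integral_mono integrable_const_bound[where B = 1]) auto
  then show "Re (charf M X s) \<le> 1" by (simp add: * prob_space)
qed

text \<open>Tonelli: the integrand is the mean of \<open>1 - cos (X \<omega> \<bullet> s)\<close>,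
  and integrating over \<open>s\<close> first gives
  \<open>levy_fun \<mu> (X \<omega>)\<close>.\<close>

lemma integral_one_minus_Re_charf:
  fixes X :: "'a \<Rightarrow> 'b::euclidean_space"
  assumes "sym_levy \<mu>" and [measurable]: "X \<in> borel_measurable M"
    and int: "integrable M (\<lambda>\<omega>. levy_fun \<mu> (X \<omega>))"
  shows "integrable \<mu> (\<lambda>s. 1 - Re (charf M X s))"
    and "(\<integral>s. 1 - Re (charf M X s) \<partial>\<mu>) = expectation (\<lambda>\<omega>. levy_fun \<mu> (X \<omega>))"
proof -
  interpret L: sym_levy \<mu> by fact
  interpret P: pair_sigma_finite M \<mu> ..
  have "(\<integral>\<^sup>+s. ennreal (1 - Re (charf M X s)) \<partial>\<mu>) = (\<integral>\<^sup>+s. \<integral>\<^sup>+\<omega>. ennreal (1 - cos (X \<omega> \<bullet> s)) \<partial>M \<partial>\<mu>)"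
  proof (rule nn_integral_cong)
    fix s
    have i: "integrable M (\<lambda>\<omega>. cos (s \<bullet> X \<omega>))"
      by (rule integrable_const_bound[where B = 1]) auto
    then have "1 - Re (charf M X s) = expectation (\<lambda>\<omega>. 1 - cos (s \<bullet> X \<omega>))"
      by (simp add: Re_charf prob_space)
    also have "ennreal \<dots> = (\<integral>\<^sup>+\<omega>. ennreal (1 - cos (s \<bullet> X \<omega>)) \<partial>M)"
      using i by (intro nn_integral_eq_integral[symmetric]) auto
    finally show "ennreal (1 - Re (charf M X s)) = (\<integral>\<^sup>+\<omega>. ennreal (1 - cos (X \<omega> \<bullet> s)) \<partial>M)"
      by (simp add: inner_commute)
  qed
  also have "\<dots> = (\<integral>\<^sup>+\<omega>. \<integral>\<^sup>+s. ennreal (1 - cos (X \<omega> \<bullet> s)) \<partial>\<mu> \<partial>M)"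
    by (rule P.Fubini') measurable
  also have "\<dots> = (\<integral>\<^sup>+\<omega>. ennreal (levy_fun \<mu> (X \<omega>)) \<partial>M)"
    by (simp add: L.nn_integral_one_minus_cos)
  also have "\<dots> = ennreal (expectation (\<lambda>\<omega>. levy_fun \<mu> (X \<omega>)))"
    using int L.levy_fun_nonneg by (intro nn_integral_eq_integral) auto
  finally have *: "(\<integral>\<^sup>+s. ennreal (1 - Re (charf M X s)) \<partial>\<mu>) = ennreal (expectation (\<lambda>\<omega>. levy_fun \<mu> (X \<omega>)))" .
  then show "integrable \<mu> (\<lambda>s. 1 - Re (charf M X s))"
    by (intro integrableI_nn_integral_finite[OF _ _ *]) (auto simp: Re_charf(2))
  show "(\<integral>s. 1 - Re (charf M X s) \<partial>\<mu>) = expectation (\<lambda>\<omega>. levy_fun \<mu> (X \<omega>))"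
    by (subst integral_eq_nn_integral) (auto simp: Re_charf(2) * L.levy_fun_nonneg integral_nonneg_AE)
qed

text \<open>With f the characteristic function at \<open>s\<close>, the left side is 1 - |f|^2,
  which is at most 1 - r^2 for r = Re f, and 1 - r^2 = 2 (1 - r) - (1 - r)^2.\<close>

lemma charf_centred_second_moment:
  assumes [measurable]: "X \<in> borel_measurable M"
  shows "expectation (\<lambda>\<omega>. (cmod (cis (s \<bullet> X \<omega>) - charf M X s))\<^sup>2) \<le> 2 * (1 - Re (charf M X s))"
proof -
  let ?f = "charf M X s"
  have i: "integrable M (\<lambda>\<omega>. cis (s \<bullet> X \<omega>))" by (rule integrable_cis) measurable
  have eq: "(cmod (cis u - ?f))\<^sup>2 = 1 - 2 * Re (cis u * cnj ?f) + (cmod ?f)\<^sup>2" for u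
  proof -
    have "(cmod (cis u - ?f))\<^sup>2 = ((cos u)\<^sup>2 + (sin u)\<^sup>2) - 2 * Re (cis u * cnj ?f) + (cmod ?f)\<^sup>2"
      unfolding cmod_power2 by (simp add: power2_eq_square algebra_simps)
    then show ?thesis by simp
  qed
  define R where "R \<omega> = Re (cis (s \<bullet> X \<omega>) * cnj ?f)" for \<omega>
  have R: "integrable M R"
    unfolding R_def using i by (intro integrable_Re) auto
  have "expectation R = Re (expectation (\<lambda>\<omega>. cis (s \<bullet> X \<omega>) * cnj ?f))"
    unfolding R_def using i by (intro integral_Re) auto
  also have "\<dots> = Re (?f * cnj ?f)" unfolding charf_def using i by simp
  also have "\<dots> = (cmod ?f)\<^sup>2" by (simp add: complex_mult_cnj cmod_power2)
  finally have "expectation (\<lambda>\<omega>. (cmod (cis (s \<bullet> X \<omega>) - ?f))\<^sup>2) = 1 - (cmod ?f)\<^sup>2"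
    unfolding eq R_def[symmetric] using R by (simp add: prob_space)
  also have "\<dots> \<le> 1 - (Re ?f)\<^sup>2" by (simp add: cmod_power2)
  also have "\<dots> \<le> 2 * (1 - Re ?f)"
    using zero_le_power2[of "1 - Re ?f"] by (simp add: power2_eq_square algebra_simps)
  finally show ?thesis .
qed

text \<open>The difference on the left is the mean of a product of two centred exponentials.
  Cauchy-Schwarz separates them, and each second moment contributes a factor 2.\<close>

lemma cmod_cov_charf_le:
  assumes [measurable]: "X \<in> borel_measurable M" "Y \<in> borel_measurable M"
  shows "(cmod (joint_charf M X Y s t - charf M X s * charf M Y t))\<^sup>2
    \<le> 4 * ((1 - Re (charf M X s)) * (1 - Re (charf M Y t)))"
proof -
  let ?f = "charf M X s" and ?g = "charf M Y t"
  define U where "U \<omega> = cis (s \<bullet> X \<omega>) - ?f" for \<omega>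
  define V where "V \<omega> = cis (t \<bullet> Y \<omega>) - ?g" for \<omega>
  have [measurable]: "U \<in> borel_measurable M" "V \<in> borel_measurable M"
    unfolding U_def V_def cis_conv_exp by measurable
  have bU: "cmod (U \<omega>) \<le> 1 + cmod ?f" and bV: "cmod (V \<omega>) \<le> 1 + cmod ?g" for \<omega>
    unfolding U_def V_def by (auto intro: order_trans[OF norm_triangle_ineq4])
  have iUV: "integrable M (\<lambda>\<omega>. cmod (U \<omega>) * cmod (V \<omega>))"
    by (rule integrable_const_bound[where B = "(1 + cmod ?f) * (1 + cmod ?g)"])
       (auto intro!: mult_mono bU bV)
  have iU: "integrable M (\<lambda>\<omega>. (cmod (U \<omega>))\<^sup>2)"
    by (rule integrable_const_bound[where B = "(1 + cmod ?f)\<^sup>2"]) (auto intro!: power_mono bU)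
  have iV: "integrable M (\<lambda>\<omega>. (cmod (V \<omega>))\<^sup>2)"
    by (rule integrable_const_bound[where B = "(1 + cmod ?g)\<^sup>2"]) (auto intro!: power_mono bV)
  have i1: "integrable M (\<lambda>\<omega>. cis (s \<bullet> X \<omega>))" and i2: "integrable M (\<lambda>\<omega>. cis (t \<bullet> Y \<omega>))"
    and i3: "integrable M (\<lambda>\<omega>. cis (s \<bullet> X \<omega> + t \<bullet> Y \<omega>))"
    by (rule integrable_cis, measurable)+
  have "U \<omega> * V \<omega> = cis (s \<bullet> X \<omega> + t \<bullet> Y \<omega>) - cis (s \<bullet> X \<omega>) * ?g - ?f * cis (t \<bullet> Y \<omega>) + ?f * ?g" for \<omega>
    unfolding U_def V_def by (simp add: algebra_simps cis_mult)
  then have "expectation (\<lambda>\<omega>. U \<omega> * V \<omega>) = joint_charf M X Y s t - ?f * ?g - ?f * ?g + ?f * ?g"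
    using i1 i2 i3 by (simp add: prob_space joint_charf_def flip: charf_def)
  then have "cmod (joint_charf M X Y s t - ?f * ?g) = cmod (expectation (\<lambda>\<omega>. U \<omega> * V \<omega>))" by simp
  also have "\<dots> \<le> expectation (\<lambda>\<omega>. cmod (U \<omega>) * cmod (V \<omega>))"
    using integral_norm_bound[of M "\<lambda>\<omega>. U \<omega> * V \<omega>"] by (simp add: norm_mult)
  finally have "(cmod (joint_charf M X Y s t - ?f * ?g))\<^sup>2 \<le> (expectation (\<lambda>\<omega>. cmod (U \<omega>) * cmod (V \<omega>)))\<^sup>2"
    by (intro power_mono) auto
  also have "\<dots> \<le> expectation (\<lambda>\<omega>. (cmod (U \<omega>))\<^sup>2) * expectation (\<lambda>\<omega>. (cmod (V \<omega>))\<^sup>2)"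
    by (intro Cauchy_Schwarz_integral iU iV iUV) auto
  also have "\<dots> \<le> (2 * (1 - Re ?f)) * (2 * (1 - Re ?g))"
    unfolding U_def V_def
    by (intro mult_mono charf_centred_second_moment integral_nonneg_AE) (auto simp: Re_charf(2))
  finally show ?thesis by (simp add: algebra_simps)
qed

end

subsection \<open>The empirical distance covariance\<close>

lemma quadruple_sum_const:
  fixes F :: "nat \<Rightarrow> nat \<Rightarrow> real"
  shows "(\<Sum>i<N. \<Sum>j<N. \<Sum>k<N. \<Sum>l<N. F i k) = (real N)\<^sup>2 * (\<Sum>i<N. \<Sum>k<N. F i k)"
    and "(\<Sum>i<N. \<Sum>j<N. \<Sum>k<N. \<Sum>l<N. F i j) = (real N)\<^sup>2 * (\<Sum>i<N. \<Sum>k<N. F i k)"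
    and "(\<Sum>i<N. \<Sum>j<N. \<Sum>k<N. \<Sum>l<N. F i l) = (real N)\<^sup>2 * (\<Sum>i<N. \<Sum>k<N. F i k)"
    and "(\<Sum>i<N. \<Sum>j<N. \<Sum>k<N. \<Sum>l<N. F k l) = (real N)\<^sup>2 * (\<Sum>i<N. \<Sum>k<N. F i k)"
  by (simp_all add: power2_eq_square mult.assoc flip: sum_distrib_left)

text \<open>With R, P, Q the sums of \<open>p i * q i\<close>, \<open>p i\<close>,
  \<open>q i\<close>, the square is (N^2 R^2 - 2 N R P Q + P^2 Q^2) / N^4. The three terms match the
  three kernels of the estimator, where each index absent from a kernel contributes a factor
  N.\<close>

lemma covariance_square:
  fixes p q :: "nat \<Rightarrow> real"
  shows "((\<Sum>i<N. p i * q i) / N - (\<Sum>i<N. p i) / N * ((\<Sum>i<N. q i) / N))\<^sup>2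
    = 1 / real N ^ 4 * (\<Sum>i<N. \<Sum>j<N. \<Sum>k<N. \<Sum>l<N.
        (p i * p k) * (q i * q k) - 2 * (p i * p j) * (q i * q l) + (p i * p j) * (q k * q l))"
proof (cases "N = 0")
  case False
  define R where "R = (\<Sum>i<N. p i * q i)"
  define P where "P = (\<Sum>i<N. p i)"
  define Q where "Q = (\<Sum>i<N. q i)"
  have 1: "(\<Sum>i<N. \<Sum>k<N. (p i * p k) * (q i * q k)) = R\<^sup>2"
    unfolding R_def power2_eq_square sum_product by (simp add: mult_ac)
  have 2: "(\<Sum>i<N. \<Sum>j<N. \<Sum>k<N. \<Sum>l<N. 2 * (p i * p j) * (q i * q l)) = 2 * real N * (R * P * Q)"
  proof -
    have "(\<Sum>i<N. \<Sum>j<N. \<Sum>k<N. \<Sum>l<N. 2 * (p i * p j) * (q i * q l))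
      = (\<Sum>i<N. \<Sum>j<N. 2 * real N * (p i * q i * p j * Q))"
      unfolding Q_def by (simp add: sum_distrib_left mult_ac)
    also have "\<dots> = 2 * real N * (\<Sum>i<N. \<Sum>j<N. (p i * q i) * p j) * Q"
      by (simp add: sum_distrib_left sum_distrib_right mult_ac)
    also have "\<dots> = 2 * real N * (R * P * Q)"
      unfolding R_def P_def sum_product by simp
    finally show ?thesis .
  qed
  have 3: "(\<Sum>i<N. \<Sum>j<N. \<Sum>k<N. \<Sum>l<N. (p i * p j) * (q k * q l)) = P\<^sup>2 * Q\<^sup>2"
  proof -
    have "(\<Sum>k<N. \<Sum>l<N. (p i * p j) * (q k * q l)) = p i * p j * Q\<^sup>2" for i j
      unfolding Q_def power2_eq_square sum_product by (simp add: sum_distrib_left)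
    then have "(\<Sum>i<N. \<Sum>j<N. \<Sum>k<N. \<Sum>l<N. (p i * p j) * (q k * q l)) = (\<Sum>i<N. \<Sum>j<N. p i * p j) * Q\<^sup>2"
      by (simp add: sum_distrib_right)
    also have "(\<Sum>i<N. \<Sum>j<N. p i * p j) = P\<^sup>2"
      unfolding P_def power2_eq_square sum_product ..
    finally show ?thesis .
  qed
  have "(\<Sum>i<N. \<Sum>j<N. \<Sum>k<N. \<Sum>l<N.
        (p i * p k) * (q i * q k) - 2 * (p i * p j) * (q i * q l) + (p i * p j) * (q k * q l))
     = (real N)\<^sup>2 * R\<^sup>2 - 2 * real N * (R * P * Q) + P\<^sup>2 * Q\<^sup>2"
    unfolding sum.distrib sum_subtractf quadruple_sum_const(1) 1 2 3 ..
  moreover have "(R / N - P / N * (Q / N))\<^sup>2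
     = 1 / real N ^ 4 * ((real N)\<^sup>2 * R\<^sup>2 - 2 * real N * (R * P * Q) + P\<^sup>2 * Q\<^sup>2)"
    using False by (simp add: field_simps power2_eq_square power4_eq_xxxx)
  ultimately show ?thesis unfolding R_def P_def Q_def by simp
qed simp

text \<open>The constants cancel as 1 - 2 + 1 = 0. The linear terms cancel because a fourfold sum of
  \<open>A\<close> or \<open>B\<close> does not depend on which of the index pairs occurring here it
  is evaluated at. This replaces cosines by \<open>1 - cos\<close>, which Levy measures can
  integrate.\<close>

lemma quadruple_sum_complement:
  fixes A B :: "nat \<Rightarrow> nat \<Rightarrow> real"
  shows "(\<Sum>i<N. \<Sum>j<N. \<Sum>k<N. \<Sum>l<N.
      (1 - A i k) * (1 - B i k) - 2 * (1 - A i j) * (1 - B i l) + (1 - A i j) * (1 - B k l))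
    = (\<Sum>i<N. \<Sum>j<N. \<Sum>k<N. \<Sum>l<N. A i k * B i k - 2 * A i j * B i l + A i j * B k l)"
proof -
  have "(\<Sum>i<N. \<Sum>j<N. \<Sum>k<N. \<Sum>l<N.
      (1 - A i k) * (1 - B i k) - 2 * (1 - A i j) * (1 - B i l) + (1 - A i j) * (1 - B k l))
    = (\<Sum>i<N. \<Sum>j<N. \<Sum>k<N. \<Sum>l<N. (A i k * B i k - 2 * A i j * B i l + A i j * B k l)
        + (A i j - A i k) + ((B i l - B i k) + (B i l - B k l)))"
    by (intro sum.cong refl) (simp add: algebra_simps)
  also have "\<dots> = (\<Sum>i<N. \<Sum>j<N. \<Sum>k<N. \<Sum>l<N. A i k * B i k - 2 * A i j * B i l + A i j * B k l)"
    unfolding sum.distrib sum_subtractf quadruple_sum_const by simp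
  finally show ?thesis .
qed

section \<open>The empirical measure on the sample indices\<close>

abbreviation empirical :: "nat \<Rightarrow> nat measure" where
  "empirical N \<equiv> measure_pmf (pmf_of_set {..<N})"

lemma integral_empirical:
  fixes f :: "nat \<Rightarrow> 'b::{banach, second_countable_topology}"
  assumes "N > 0"
  shows "integral\<^sup>L (empirical N) f = (\<Sum>i<N. f i) /\<^sub>R real N"
proof -
  have "{..<N} \<noteq> {}" using assms by (simp add: lessThan_empty_iff)
  then show ?thesis
    by (subst integral_measure_pmf[of "{..<N}"])
       (auto simp: pmf_of_set set_pmf_of_set scaleR_sum_right inverse_eq_divide)
qed

text \<open>With the sample as a random variable on its indices, the empirical characteristic
  functions are instances of \<open>charf\<close> and \<open>joint_charf\<close>, so every bound
  proved for these applies to samples.\<close>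

lemma charf_empirical:
  assumes "N > 0"
  shows "charf (empirical N) x s = (\<Sum>i<N. cis (s \<bullet> x i)) /\<^sub>R real N"
    and "joint_charf (empirical N) x y s t = (\<Sum>i<N. cis (s \<bullet> x i + t \<bullet> y i)) /\<^sub>R real N"
  using assms by (simp_all add: charf_def joint_charf_def integral_empirical)

text \<open>The real and imaginary parts of \<open>h s t\<close> and \<open>h (- s) t\<close> are
  sums and differences of covariances of cosine and sine sequences. Adding the two squared moduli
  removes the mixed terms and leaves four squares, which \<open>covariance_square\<close> expands;
  the addition theorem then restores cosines of differences.\<close>

lemma empirical_covariance_symmetrised:
  fixes x :: "nat \<Rightarrow> 'a::euclidean_space" and y :: "nat \<Rightarrow> 'b::euclidean_space"
  assumes N: "N > 0"
  defines "h \<equiv> \<lambda>s t. joint_charf (empirical N) x y s t - charf (empirical N) x s * charf (empirical N) y t"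
  shows "(cmod (h s t))\<^sup>2 + (cmod (h (- s) t))\<^sup>2 = 2 * (1 / real N ^ 4 * (\<Sum>i<N. \<Sum>j<N. \<Sum>k<N. \<Sum>l<N.
      (1 - cos ((x i - x k) \<bullet> s)) * (1 - cos ((y i - y k) \<bullet> t))
      - 2 * (1 - cos ((x i - x j) \<bullet> s)) * (1 - cos ((y i - y l) \<bullet> t))
      + (1 - cos ((x i - x j) \<bullet> s)) * (1 - cos ((y k - y l) \<bullet> t))))"
proof -
  define c where "c i = cos (s \<bullet> x i)" for i
  define d where "d i = sin (s \<bullet> x i)" for i
  define u where "u i = cos (t \<bullet> y i)" for i
  define v where "v i = sin (t \<bullet> y i)" for i
  define cov where "cov p q = (\<Sum>i<N. p i * q i) / N - (\<Sum>i<N. p i) / N * ((\<Sum>i<N. q i) / N)"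
    for p q :: "nat \<Rightarrow> real"
  have 1: "Re (h s t) = cov c u - cov d v" "Im (h s t) = cov c v + cov d u"
    "Re (h (- s) t) = cov c u + cov d v" "Im (h (- s) t) = cov c v - cov d u"
    unfolding h_def cov_def charf_empirical[OF N] c_def d_def u_def v_def
    by (simp_all add: cos_add sin_add cos_diff sin_diff sum.distrib sum_subtractf sum_negf divide_inverse algebra_simps)
  have 2: "(cmod (h s t))\<^sup>2 + (cmod (h (- s) t))\<^sup>2 = 2 * ((cov c u)\<^sup>2 + (cov d v)\<^sup>2 + (cov c v)\<^sup>2 + (cov d u)\<^sup>2)"
    unfolding cmod_power2 1 by (simp add: power2_eq_square algebra_simps)
  have A: "cos ((x i - x j) \<bullet> s) = c i * c j + d i * d j" for i j
    unfolding c_def d_def inner_diff_left by (simp add: cos_diff inner_commute)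
  have B: "cos ((y i - y j) \<bullet> t) = u i * u j + v i * v j" for i j
    unfolding u_def v_def inner_diff_left by (simp add: cos_diff inner_commute)
  have "(cov c u)\<^sup>2 + (cov d v)\<^sup>2 + (cov c v)\<^sup>2 + (cov d u)\<^sup>2
    = 1 / real N ^ 4 * (\<Sum>i<N. \<Sum>j<N. \<Sum>k<N. \<Sum>l<N.
        (c i * c k + d i * d k) * (u i * u k + v i * v k)
        - 2 * (c i * c j + d i * d j) * (u i * u l + v i * v l)
        + (c i * c j + d i * d j) * (u k * u l + v k * v l))"
    unfolding cov_def covariance_square distrib_left[symmetric] sum.distrib[symmetric]
    by (intro arg_cong2[where f = "(*)"] sum.cong refl) (simp add: algebra_simps)
  then show ?thesis
    unfolding 2 quadruple_sum_complement[where N = N and A = "\<lambda>i j. cos ((x i - x j) \<bullet> s)" and B = "\<lambda>i j. cos ((y i - y j) \<bullet> t)"]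
    unfolding A B by simp
qed

section \<open>Distance covariance as an integral over the product measure\<close>

locale sym_levy_pair = L1: sym_levy \<mu> + L2: sym_levy \<nu>
  for \<mu> :: "'a::euclidean_space measure" and \<nu> :: "'b::euclidean_space measure"
begin

sublocale pair_sigma_finite \<mu> \<nu> ..

lemma integral_mult:
  fixes f g :: "_ \<Rightarrow> real"
  assumes f: "integrable \<mu> f" and g: "integrable \<nu> g"
  shows "integrable (\<mu> \<Otimes>\<^sub>M \<nu>) (\<lambda>z. f (fst z) * g (snd z))"
    and "(\<integral>z. f (fst z) * g (snd z) \<partial>(\<mu> \<Otimes>\<^sub>M \<nu>)) = integral\<^sup>L \<mu> f * integral\<^sup>L \<nu> g"
proof -
  have [measurable]: "f \<in> borel_measurable \<mu>" "g \<in> borel_measurable \<nu>" using f g by auto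
  show *: "integrable (\<mu> \<Otimes>\<^sub>M \<nu>) (\<lambda>z. f (fst z) * g (snd z))"
  proof (rule Fubini_integrable)
    show "integrable \<mu> (\<lambda>x. \<integral>y. norm (f (fst (x, y)) * g (snd (x, y))) \<partial>\<nu>)"
      using f g by (simp add: abs_mult)
  qed (use g in auto)
  show "(\<integral>z. f (fst z) * g (snd z) \<partial>(\<mu> \<Otimes>\<^sub>M \<nu>)) = integral\<^sup>L \<mu> f * integral\<^sup>L \<nu> g"
    using integral_fst'[OF *] by simp
qed

text \<open>The probability space is a parameter, so that one function covers both the true law and
  the empirical ones.\<close>

definition dcov_integrand :: "'w measure \<Rightarrow> ('w \<Rightarrow> 'a) \<Rightarrow> ('w \<Rightarrow> 'b) \<Rightarrow> 'a \<times> 'b \<Rightarrow> real" where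
  "dcov_integrand M X Y z =
     (cmod (joint_charf M X Y (fst z) (snd z) - charf M X (fst z) * charf M Y (snd z)))\<^sup>2"

lemma dcov_integrand_measurable:
  assumes "prob_space M" and [measurable]: "X \<in> borel_measurable M" "Y \<in> borel_measurable M"
  shows "dcov_integrand M X Y \<in> borel_measurable (borel \<Otimes>\<^sub>M borel)"
proof -
  interpret prob_space M by fact
  note borel_prod[measurable_cong]
  show ?thesis
    unfolding dcov_integrand_def[abs_def] joint_charf_eq_charf by measurable
qed

lemma dcov2_eq_nn_integral:
  assumes "prob_space M" and [measurable]: "X \<in> borel_measurable M" "Y \<in> borel_measurable M"
  shows "dcov2 \<mu> \<nu> M X Y = (\<integral>\<^sup>+z. ennreal (dcov_integrand M X Y z) \<partial>(\<mu> \<Otimes>\<^sub>M \<nu>))"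
proof -
  note dcov_integrand_measurable[OF assms, measurable]
  have "(\<lambda>z. ennreal (dcov_integrand M X Y z)) \<in> borel_measurable (\<mu> \<Otimes>\<^sub>M \<nu>)" by measurable
  from L2.nn_integral_fst[OF this] show ?thesis
    unfolding dcov2_def by (simp add: dcov_integrand_def)
qed

text \<open>The majorant from \<open>cmod_cov_charf_le\<close> is a product of functions of the two
  coordinates, so its integral factorises. The lemma is applied to the law of \<open>(X, Y)\<close>
  and to every empirical measure of a nonempty sample.\<close>

lemma dominating_integral:
  assumes "prob_space M" and [measurable]: "X \<in> borel_measurable M" "Y \<in> borel_measurable M"
    and "integrable M (\<lambda>\<omega>. levy_fun \<mu> (X \<omega>))" "integrable M (\<lambda>\<omega>. levy_fun \<nu> (Y \<omega>))"
  defines "g \<equiv> \<lambda>z. 4 * ((1 - Re (charf M X (fst z))) * (1 - Re (charf M Y (snd z))))"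
  shows "integrable (\<mu> \<Otimes>\<^sub>M \<nu>) g"
    and "integral\<^sup>L (\<mu> \<Otimes>\<^sub>M \<nu>) g = 4 * ((\<integral>\<omega>. levy_fun \<mu> (X \<omega>) \<partial>M) * (\<integral>\<omega>. levy_fun \<nu> (Y \<omega>) \<partial>M))"
    and "dcov_integrand M X Y z \<le> g z"
    and "integrable (\<mu> \<Otimes>\<^sub>M \<nu>) (dcov_integrand M X Y)"
proof -
  interpret prob_space M by fact
  note 1 = integral_one_minus_Re_charf[OF L1.sym_levy_axioms assms(2,4)]
    and 2 = integral_one_minus_Re_charf[OF L2.sym_levy_axioms assms(3,5)]
  show ig: "integrable (\<mu> \<Otimes>\<^sub>M \<nu>) g"
    unfolding g_def by (intro integrable_mult_right integral_mult 1 2)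
  show "integral\<^sup>L (\<mu> \<Otimes>\<^sub>M \<nu>) g = 4 * ((\<integral>\<omega>. levy_fun \<mu> (X \<omega>) \<partial>M) * (\<integral>\<omega>. levy_fun \<nu> (Y \<omega>) \<partial>M))"
    unfolding g_def using integral_mult[OF 1(1) 2(1)] by (simp add: 1 2)
  show le: "dcov_integrand M X Y z \<le> g z" for z
    unfolding dcov_integrand_def g_def by (rule cmod_cov_charf_le) measurable
  show "integrable (\<mu> \<Otimes>\<^sub>M \<nu>) (dcov_integrand M X Y)"
  proof (rule Bochner_Integration.integrable_bound[OF ig])
    show "AE z in \<mu> \<Otimes>\<^sub>M \<nu>. norm (dcov_integrand M X Y z) \<le> norm (g z)"
      using le by (auto intro!: AE_I2 order_trans[OF _ abs_ge_self] simp: dcov_integrand_def)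
    note dcov_integrand_measurable[OF assms(1-3), measurable]
    show "dcov_integrand M X Y \<in> borel_measurable (\<mu> \<Otimes>\<^sub>M \<nu>)" by measurable
  qed
qed

text \<open>Integrate \<open>empirical_covariance_symmetrised\<close>: reflecting the first
  coordinate leaves the integral unchanged by symmetry of \<open>\<mu>\<close>, so both sides carry
  the same factor 2.\<close>

lemma dcov2_empirical:
  assumes N: "N > 0"
  shows "(\<integral>z. dcov_integrand (empirical N) x y z \<partial>(\<mu> \<Otimes>\<^sub>M \<nu>)) = dcov2_est (levy_fun \<mu>) (levy_fun \<nu>) N x y"
proof -
  let ?u = "dcov_integrand (empirical N) x y"
  have ps: "prob_space (empirical N)" by unfold_locales
  have fin: "finite (set_pmf (pmf_of_set {..<N}))"
    using N by (subst set_pmf_of_set) auto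
  note [measurable] = dcov_integrand_measurable[OF ps, of x y, simplified]
  have int: "integrable (\<mu> \<Otimes>\<^sub>M \<nu>) ?u"
    by (rule dominating_integral) (auto intro: ps integrable_measure_pmf_finite fin)
  have nn: "?u z \<ge> 0" for z by (simp add: dcov_integrand_def)
  \<comment> \<open>Each summand is a product of functions \<open>1 - cos\<close>, hence integrable,
    so \<open>K\<close> can be integrated term by term.\<close>
  define K where "K z = 1 / real N ^ 4 * (\<Sum>i<N. \<Sum>j<N. \<Sum>k<N. \<Sum>l<N.
      (1 - cos ((x i - x k) \<bullet> fst z)) * (1 - cos ((y i - y k) \<bullet> snd z))
      - 2 * ((1 - cos ((x i - x j) \<bullet> fst z)) * (1 - cos ((y i - y l) \<bullet> snd z)))
      + (1 - cos ((x i - x j) \<bullet> fst z)) * (1 - cos ((y k - y l) \<bullet> snd z)))" for z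
  have K: "?u z + ?u (- fst z, snd z) = 2 * K z" for z
    unfolding dcov_integrand_def K_def
    using empirical_covariance_symmetrised[OF N, of x y "fst z" "snd z"] by (simp only: mult.assoc fst_conv snd_conv)
  note im = integral_mult[OF L1.integrable_one_minus_cos L2.integrable_one_minus_cos]
  have intK: "(\<integral>z. K z \<partial>(\<mu> \<Otimes>\<^sub>M \<nu>)) = dcov2_est (levy_fun \<mu>) (levy_fun \<nu>) N x y"
    unfolding K_def dcov2_est_def
    by (simp add: im mult.assoc Bochner_Integration.integral_sum Bochner_Integration.integrable_sum flip: levy_fun_def)
  \<comment> \<open>Stated for the nonnegative integral, this also yields integrability of the
    reflected function.\<close>
  have refl_nn: "(\<integral>\<^sup>+z. ennreal (?u (- fst z, snd z)) \<partial>(\<mu> \<Otimes>\<^sub>M \<nu>)) = (\<integral>\<^sup>+z. ennreal (?u z) \<partial>(\<mu> \<Otimes>\<^sub>M \<nu>))"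
  proof -
    have "(\<lambda>z. ennreal (?u (- fst z, snd z))) \<in> borel_measurable (\<mu> \<Otimes>\<^sub>M \<nu>)" by measurable
    from L2.nn_integral_fst[OF this]
    have "(\<integral>\<^sup>+z. ennreal (?u (- fst z, snd z)) \<partial>(\<mu> \<Otimes>\<^sub>M \<nu>)) = (\<integral>\<^sup>+s. \<integral>\<^sup>+t. ennreal (?u (- s, t)) \<partial>\<nu> \<partial>\<mu>)"
      by simp
    also have "\<dots> = (\<integral>\<^sup>+s. \<integral>\<^sup>+t. ennreal (?u (s, t)) \<partial>\<nu> \<partial>\<mu>)"
      by (rule L1.nn_integral_reflect[of "\<lambda>s. \<integral>\<^sup>+t. ennreal (?u (s, t)) \<partial>\<nu>"]) measurable
    also have "\<dots> = (\<integral>\<^sup>+z. ennreal (?u z) \<partial>(\<mu> \<Otimes>\<^sub>M \<nu>))"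
      by (rule L2.nn_integral_fst) measurable
    finally show ?thesis .
  qed
  have m': "(\<lambda>z. ?u (- fst z, snd z)) \<in> borel_measurable (\<mu> \<Otimes>\<^sub>M \<nu>)" by measurable
  have int': "integrable (\<mu> \<Otimes>\<^sub>M \<nu>) (\<lambda>z. ?u (- fst z, snd z))"
    using int nn unfolding integrable_iff_bounded by (simp add: refl_nn m')
  have "(\<integral>z. ?u (- fst z, snd z) \<partial>(\<mu> \<Otimes>\<^sub>M \<nu>)) = (\<integral>z. ?u z \<partial>(\<mu> \<Otimes>\<^sub>M \<nu>))"
    by (subst (1 2) integral_eq_nn_integral) (auto simp: nn refl_nn)
  moreover have "(\<integral>z. ?u z \<partial>(\<mu> \<Otimes>\<^sub>M \<nu>)) + (\<integral>z. ?u (- fst z, snd z) \<partial>(\<mu> \<Otimes>\<^sub>M \<nu>)) = (\<integral>z. 2 * K z \<partial>(\<mu> \<Otimes>\<^sub>M \<nu>))"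
    using int int' by (simp flip: K)
  ultimately show ?thesis by (simp add: intK)
qed

end

section \<open>Convergence of empirical characteristic functions\<close>

lemma (in prob_space) empirical_charf_converges:
  fixes Z :: "nat \<Rightarrow> 'a \<Rightarrow> 'c::euclidean_space"
  assumes ind: "indep_vars (\<lambda>_. borel) Z UNIV" and [measurable]: "Y \<in> borel_measurable M"
    and id: "\<And>i. distr M borel (Z i) = distr M borel Y"
  shows "AE \<omega> in M. (\<lambda>N. (\<Sum>i<N. cis (s \<bullet> Z i \<omega>)) /\<^sub>R real N) \<longlonglongrightarrow> charf M Y s"
proof -
  have Z[measurable]: "Z i \<in> borel_measurable M" for i
    using ind by (auto simp: indep_vars_def)
  have cis: "integrable M (\<lambda>\<omega>. cis (s \<bullet> Y \<omega>))" by (rule integrable_cis) measurable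
  have lln: "AE \<omega> in M. (\<lambda>N. (\<Sum>i<N. f (s \<bullet> Z i \<omega>)) / real N) \<longlonglongrightarrow> expectation (\<lambda>\<omega>. f (s \<bullet> Y \<omega>))"
    if [measurable]: "f \<in> borel_measurable borel" and f: "\<And>u. \<bar>f u\<bar> \<le> 1" for f :: "real \<Rightarrow> real"
  proof (rule strong_law_bounded[where B = 1])
    show "indep_vars (\<lambda>_. borel) (\<lambda>i \<omega>. f (s \<bullet> Z i \<omega>)) UNIV"
      by (rule indep_vars_compose2[OF ind]) simp
    show "distr M borel (\<lambda>\<omega>. f (s \<bullet> Z i \<omega>)) = distr M borel (\<lambda>\<omega>. f (s \<bullet> Y \<omega>))" for i
    proof -
      have "distr (distr M borel (Z i)) borel (\<lambda>z. f (s \<bullet> z)) = distr (distr M borel Y) borel (\<lambda>z. f (s \<bullet> z))"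
        by (simp add: id)
      then show ?thesis by (simp add: distr_distr comp_def)
    qed
  qed (use f in auto)
  have "AE \<omega> in M. (\<lambda>N. (\<Sum>i<N. cos (s \<bullet> Z i \<omega>)) / real N) \<longlonglongrightarrow> expectation (\<lambda>\<omega>. cos (s \<bullet> Y \<omega>))"
    "AE \<omega> in M. (\<lambda>N. (\<Sum>i<N. sin (s \<bullet> Z i \<omega>)) / real N) \<longlonglongrightarrow> expectation (\<lambda>\<omega>. sin (s \<bullet> Y \<omega>))"
    by (rule lln; simp)+
  then show ?thesis
  proof eventually_elim
    case (elim \<omega>)
    have "Re (charf M Y s) = expectation (\<lambda>\<omega>. cos (s \<bullet> Y \<omega>))" "Im (charf M Y s) = expectation (\<lambda>\<omega>. sin (s \<bullet> Y \<omega>))"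
      unfolding charf_def using integral_Re[OF cis] integral_Im[OF cis] by simp_all
    then show ?case
      using elim unfolding tendsto_complex_iff by (simp add: divide_inverse mult.commute)
  qed
qed

text \<open>The null set of \<open>empirical_charf_converges\<close> depends on the frequency;
  Fubini exchanges the two quantifiers. The map \<open>L\<close> lets frequencies on either factor
  and on the product all be read off from one measure \<open>P\<close>.\<close>

lemma (in prob_space) empirical_charf_converges_AE:
  fixes Z :: "nat \<Rightarrow> 'a \<Rightarrow> 'c::euclidean_space"
  assumes ind: "indep_vars (\<lambda>_. borel) Z UNIV" and Y[measurable]: "Y \<in> borel_measurable M"
    and id: "\<And>i. distr M borel (Z i) = distr M borel Y"
    and "sigma_finite_measure P" and L[measurable]: "L \<in> borel_measurable P"
  shows "AE \<omega> in M. AE z in P. (\<lambda>N. (\<Sum>i<N. cis (L z \<bullet> Z i \<omega>)) /\<^sub>R real N) \<longlonglongrightarrow> charf M Y (L z)"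
proof -
  interpret P: sigma_finite_measure P by fact
  interpret MP: pair_sigma_finite M P ..
  have Z[measurable]: "Z i \<in> borel_measurable M" for i
    using ind by (auto simp: indep_vars_def)
  have "AE z in P. AE \<omega> in M. (\<lambda>N. (\<Sum>i<N. cis (L z \<bullet> Z i \<omega>)) /\<^sub>R real N) \<longlonglongrightarrow> charf M Y (L z)"
    by (intro AE_I2 empirical_charf_converges ind Y id)
  moreover have "{x \<in> space (M \<Otimes>\<^sub>M P). (\<lambda>N. (\<Sum>i<N. cis (L (snd x) \<bullet> Z i (fst x))) /\<^sub>R real N)
      \<longlonglongrightarrow> charf M Y (L (snd x))} \<in> sets (M \<Otimes>\<^sub>M P)"
    by (rule sets_Collect_tendsto) (unfold cis_conv_exp, measurable)
  ultimately show ?thesis by (subst MP.AE_commute) auto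
qed

section \<open>Strong consistency of the estimator\<close>

theorem theorem4p4:
  fixes \<mu> :: "'a::euclidean_space measure" and \<nu> :: "'b::euclidean_space measure"
    and M :: "'w measure"
    and X :: "'w \<Rightarrow> 'a" and Y :: "'w \<Rightarrow> 'b"
    and Xs :: "nat \<Rightarrow> 'w \<Rightarrow> 'a" and Ys :: "nat \<Rightarrow> 'w \<Rightarrow> 'b"
  assumes "sym_levy_measure \<mu>" and "full_support \<mu>"
    and "sym_levy_measure \<nu>" and "full_support \<nu>"
    and "prob_space M"
    and "X \<in> borel_measurable M" and "Y \<in> borel_measurable M"
    and "(\<integral>\<^sup>+ \<omega>. ennreal (levy_fun \<mu> (X \<omega>) + levy_fun \<nu> (Y \<omega>)) \<partial>M) < \<infinity>"
    and "\<And>i. Xs i \<in> borel_measurable M" and "\<And>i. Ys i \<in> borel_measurable M"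
    and "prob_space.indep_vars M (\<lambda>_. borel) (\<lambda>i \<omega>. (Xs i \<omega>, Ys i \<omega>)) UNIV"
    and "\<And>i. distr M borel (\<lambda>\<omega>. (Xs i \<omega>, Ys i \<omega>)) = distr M borel (\<lambda>\<omega>. (X \<omega>, Y \<omega>))"
  shows "dcov2 \<mu> \<nu> M X Y < \<infinity> \<and>
    (AE \<omega> in M. (\<lambda>N. dcov2_est (levy_fun \<mu>) (levy_fun \<nu>) N (\<lambda>i. Xs i \<omega>) (\<lambda>i. Ys i \<omega>))
        \<longlonglongrightarrow> enn2real (dcov2 \<mu> \<nu> M X Y))"
proof -
  interpret prob_space M by fact
  interpret L: sym_levy_pair \<mu> \<nu> by unfold_locales fact+
  let ?P = "\<mu> \<Otimes>\<^sub>M \<nu>"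
  note [measurable] = assms(6,7,9,10)
  note ind = assms(11) and id = assms(12)
  have ps: "prob_space M" by fact
  have marginal: "distr M borel (\<lambda>\<omega>. f (Xs i \<omega>, Ys i \<omega>)) = distr M borel (\<lambda>\<omega>. f (X \<omega>, Y \<omega>))"
    if [measurable]: "f \<in> borel_measurable borel" for f :: "'a \<times> 'b \<Rightarrow> 'c::topological_space" and i
  proof -
    have "distr (distr M borel (\<lambda>\<omega>. (Xs i \<omega>, Ys i \<omega>))) borel f = distr (distr M borel (\<lambda>\<omega>. (X \<omega>, Y \<omega>))) borel f"
      by (simp add: id)
    then show ?thesis by (simp add: distr_distr comp_def)
  qed
  have proj[measurable]: "fst \<in> borel_measurable (borel :: ('a \<times> 'b) measure)"
    "snd \<in> borel_measurable (borel :: ('a \<times> 'b) measure)"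
    by (simp_all add: borel_measurable_continuous_onI continuous_on_fst continuous_on_snd)

  have "integrable M (\<lambda>\<omega>. levy_fun \<mu> (X \<omega>) + levy_fun \<nu> (Y \<omega>))"
    using assms(8) L.L1.levy_fun_nonneg L.L2.levy_fun_nonneg by (intro integrableI_nonneg) auto
  then have intX: "integrable M (\<lambda>\<omega>. levy_fun \<mu> (X \<omega>))" and intY: "integrable M (\<lambda>\<omega>. levy_fun \<nu> (Y \<omega>))"
    using L.L1.levy_fun_nonneg L.L2.levy_fun_nonneg
    by (auto intro: Bochner_Integration.integrable_bound)
  note dom = L.dominating_integral[OF ps assms(6,7) intX intY]
  have nn: "L.dcov_integrand Q x y z \<ge> 0" for Q :: "'q measure" and x y z
    by (simp add: L.dcov_integrand_def)
  \<comment> \<open>The integrable majorant makes the distance covariance finite and turns it into a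
    real integral.\<close>
  have dcov: "dcov2 \<mu> \<nu> M X Y = ennreal (\<integral>z. L.dcov_integrand M X Y z \<partial>?P)"
    unfolding L.dcov2_eq_nn_integral[OF ps assms(6,7)] by (intro nn_integral_eq_integral dom(4) AE_I2 nn)

  have "AE \<omega> in M. (\<lambda>N. (\<Sum>i<N. levy_fun \<mu> (Xs i \<omega>)) / real N) \<longlonglongrightarrow> expectation (\<lambda>\<omega>. levy_fun \<mu> (X \<omega>))"
    using indep_vars_compose2[OF ind, of "\<lambda>_ z. levy_fun \<mu> (fst z)" "\<lambda>_. borel"]
      marginal[of "\<lambda>z. levy_fun \<mu> (fst z)"] intX
    by (intro strong_law_nonneg) (auto simp: L.L1.levy_fun_nonneg)
  moreover have "AE \<omega> in M. (\<lambda>N. (\<Sum>i<N. levy_fun \<nu> (Ys i \<omega>)) / real N) \<longlonglongrightarrow> expectation (\<lambda>\<omega>. levy_fun \<nu> (Y \<omega>))"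
    using indep_vars_compose2[OF ind, of "\<lambda>_ z. levy_fun \<nu> (snd z)" "\<lambda>_. borel"]
      marginal[of "\<lambda>z. levy_fun \<nu> (snd z)"] intY
    by (intro strong_law_nonneg) (auto simp: L.L2.levy_fun_nonneg)
  moreover have "AE \<omega> in M. AE z in ?P. (\<lambda>N. (\<Sum>i<N. cis (fst z \<bullet> Xs i \<omega>)) /\<^sub>R real N) \<longlonglongrightarrow> charf M X (fst z)"
    using indep_vars_compose2[OF ind, of "\<lambda>_. fst" "\<lambda>_. borel"] marginal[of fst]
    by (intro empirical_charf_converges_AE) (auto intro: L.sigma_finite_measure_axioms)
  moreover have "AE \<omega> in M. AE z in ?P. (\<lambda>N. (\<Sum>i<N. cis (snd z \<bullet> Ys i \<omega>)) /\<^sub>R real N) \<longlonglongrightarrow> charf M Y (snd z)"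
    using indep_vars_compose2[OF ind, of "\<lambda>_. snd" "\<lambda>_. borel"] marginal[of snd]
    by (intro empirical_charf_converges_AE) (auto intro: L.sigma_finite_measure_axioms)
  moreover have "AE \<omega> in M. AE z in ?P. (\<lambda>N. (\<Sum>i<N. cis ((fst z, snd z) \<bullet> (Xs i \<omega>, Ys i \<omega>))) /\<^sub>R real N)
      \<longlonglongrightarrow> charf M (\<lambda>\<omega>. (X \<omega>, Y \<omega>)) (fst z, snd z)"
    by (intro empirical_charf_converges_AE[OF ind _ id L.sigma_finite_measure_axioms] borel_measurable_Pair) measurable
  ultimately have "AE \<omega> in M. (\<lambda>N. dcov2_est (levy_fun \<mu>) (levy_fun \<nu>) N (\<lambda>i. Xs i \<omega>) (\<lambda>i. Ys i \<omega>))
        \<longlonglongrightarrow> (\<integral>z. L.dcov_integrand M X Y z \<partial>?P)"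
  proof eventually_elim
    case (elim \<omega>)
    \<comment> \<open>The sample point is now fixed outside five null sets, and the rest is
      deterministic.\<close>
    define x where "x i = Xs i \<omega>" for i
    define y where "y i = Ys i \<omega>" for i
    have emp: "prob_space (empirical N)" for N by unfold_locales
    have fin: "finite (set_pmf (pmf_of_set {..<Suc N}))" for N
      by (subst set_pmf_of_set) (auto simp: lessThan_empty_iff)
    have int_emp: "integrable (empirical (Suc N)) f" for f :: "nat \<Rightarrow> real" and N
      by (rule integrable_measure_pmf_finite[OF fin])
    have meas: "f \<in> borel_measurable (empirical N)" for f :: "nat \<Rightarrow> 'z::topological_space" and N
      by simp
    note emp_dom = L.dominating_integral[OF emp meas meas int_emp int_emp]
    \<comment> \<open>Sample sizes are shifted by one so that the uniform law on the indices always
      exists; \<open>LIMSEQ_imp_Suc\<close> undoes the shift.\<close>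
    let ?u = "\<lambda>N. L.dcov_integrand (empirical (Suc N)) x y"
    let ?g = "\<lambda>N z. 4 * ((1 - Re (charf (empirical (Suc N)) x (fst z))) * (1 - Re (charf (empirical (Suc N)) y (snd z))))"
    let ?g' = "\<lambda>z. 4 * ((1 - Re (charf M X (fst z))) * (1 - Re (charf M Y (snd z))))"
    have lim: "AE z in ?P. (\<lambda>N. charf (empirical (Suc N)) x (fst z)) \<longlonglongrightarrow> charf M X (fst z) \<and>
      (\<lambda>N. charf (empirical (Suc N)) y (snd z)) \<longlonglongrightarrow> charf M Y (snd z) \<and>
      (\<lambda>N. joint_charf (empirical (Suc N)) x y (fst z) (snd z)) \<longlonglongrightarrow> joint_charf M X Y (fst z) (snd z)"
      using elim(3-5)
      by eventually_elim
        (auto simp: charf_empirical x_def y_def joint_charf_eq_charf inner_Pair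
          simp del: sum.lessThan_Suc of_nat_Suc intro: LIMSEQ_Suc)
    have "(\<lambda>N. integral\<^sup>L ?P (?u N)) \<longlonglongrightarrow> (\<integral>z. L.dcov_integrand M X Y z \<partial>?P)"
    proof (rule integral_tendsto_if_dominating_integrals_tendsto)
      show "?u N \<in> borel_measurable ?P" for N using emp_dom(4) by auto
      show "L.dcov_integrand M X Y \<in> borel_measurable ?P" using dom(4) by auto
      show "integrable ?P (?g N)" for N by (rule emp_dom(1))
      show "integrable ?P ?g'" by (rule dom(1))
      show "?u N z \<ge> 0" for N z by (rule nn)
      show "?u N z \<le> ?g N z" for N z by (rule emp_dom(3))
      show "AE z in ?P. (\<lambda>N. ?u N z) \<longlonglongrightarrow> L.dcov_integrand M X Y z"
        using lim unfolding L.dcov_integrand_def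
        by eventually_elim (intro tendsto_intros; simp)
      show "AE z in ?P. (\<lambda>N. ?g N z) \<longlonglongrightarrow> ?g' z"
        using lim by eventually_elim (intro tendsto_intros; simp)
      \<comment> \<open>The integrals of the empirical majorants are products of sample means, so
        the strong law for the Levy functions gives their convergence.\<close>
      have "integral\<^sup>L ?P (?g N) = 4 * ((\<Sum>i<Suc N. levy_fun \<mu> (Xs i \<omega>)) / real (Suc N)
          * ((\<Sum>i<Suc N. levy_fun \<nu> (Ys i \<omega>)) / real (Suc N)))" for N
        unfolding emp_dom(2) integral_empirical[OF zero_less_Suc]
        by (simp add: x_def y_def divide_inverse mult_ac del: sum.lessThan_Suc of_nat_Suc)
      then show "(\<lambda>N. integral\<^sup>L ?P (?g N)) \<longlonglongrightarrow> integral\<^sup>L ?P ?g'"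
        unfolding dom(2) using LIMSEQ_Suc[OF elim(1)] LIMSEQ_Suc[OF elim(2)]
        by (simp only:) (intro tendsto_intros)
    qed
    then have "(\<lambda>N. dcov2_est (levy_fun \<mu>) (levy_fun \<nu>) (Suc N) x y) \<longlonglongrightarrow> (\<integral>z. L.dcov_integrand M X Y z \<partial>?P)"
      by (simp only: L.dcov2_empirical[OF zero_less_Suc])
    then show ?case
      unfolding x_def y_def by (rule LIMSEQ_imp_Suc)
  qed
  moreover have "enn2real (dcov2 \<mu> \<nu> M X Y) = (\<integral>z. L.dcov_integrand M X Y z \<partial>?P)"
    unfolding dcov by (intro enn2real_ennreal integral_nonneg_AE AE_I2 nn)
  ultimately show ?thesis by (simp add: dcov)
qed

end
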